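(* Let $p$ be a prime, let $G$ be a finite $p$-group and let $k$ be a field of characteristic $p$. Let $\alpha$ be any $k$-algebra automorphism of the group algebra $kG$, and let $\lambda\in k^\times$ be the element such that $\alpha$ acts on the socle of $kG$ as multiplication by $\lambda$. Then $\lambda\in (k^\times)^{p-1}$. In particular, if $k=\mathbb{F}_p$ then $\lambda=1$.
   Context: The socle of $kG$ is one dimensional over $k$, spanned by the sum $n=\sum_{g\in G}g$ of the group elements. Hence for every $k$-algebra automorphism $\alpha$ of $kG$ there is a unique $\lambda\in k^\times$ with $\alpha(n)=\lambda n$; this is the $\lambda$ in the claim. Here $(k^\times)^{p-1}=\{\mu^{p-1}\mid \mu\in k^\times\}$. *)

theory Defs
  imports
    "HOL-Library.Poly_Mapping"
    "HOL-Library.Cardinality"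
    "HOL-Computational_Algebra.Computational_Algebra"
begin

text \<open>
  For a group written additively (class \<^class>\<open>group_add\<close>, which does not assume
  commutativity), the type \<open>'g \<Rightarrow>\<^sub>0 'k\<close> with its library ring structure is the group algebra
  of \<open>'g\<close> over \<open>'k\<close>: addition is pointwise, multiplication is convolution, and the group
  element \<open>g\<close> is \<open>Poly_Mapping.single g 1\<close>.
\<close>

type_synonym ('g, 'k) group_algebra = "'g \<Rightarrow>\<^sub>0 'k"

definition scale :: "'k::field \<Rightarrow> ('g, 'k) group_algebra \<Rightarrow> ('g, 'k) group_algebra"
  (infixr \<open>\<cdot>\<close> 75)
  where "c \<cdot> x = Poly_Mapping.map (\<lambda>a. c * a) x"

lemma lookup_scale: "Poly_Mapping.lookup (c \<cdot> x) g = c * Poly_Mapping.lookup x g"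
  by (simp add: scale_def Poly_Mapping.map.rep_eq when_def)

lemma vector_space_scale:
  "vector_space (scale :: 'k::field \<Rightarrow> ('g, 'k) group_algebra \<Rightarrow> ('g, 'k) group_algebra)"
  by unfold_locales
    (auto intro!: poly_mapping_eqI simp: lookup_scale lookup_add algebra_simps)

lemma lookup_times_group_algebra:
  fixes x y :: "('g::{finite, group_add}, 'k::field) group_algebra"
  shows "Poly_Mapping.lookup (x * y) g =
    (\<Sum>h\<in>UNIV. Poly_Mapping.lookup x h * Poly_Mapping.lookup y (- h + g))"
proof -
  have "(\<Sum>q\<in>UNIV. (Poly_Mapping.lookup y q when g = h + q)) = Poly_Mapping.lookup y (- h + g)"
    for h
  proof -
    have "g = h + q \<longleftrightarrow> q = - h + g" for q
      by (metis add.assoc add.left_neutral add.right_inverse left_minus)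
    then show ?thesis
      by (simp add: when_def)
  qed
  moreover have "Sum_any f = sum f UNIV" for f :: "'g \<Rightarrow> 'k"
    by (rule Sum_any.expand_superset) auto
  ultimately show ?thesis
    by (simp add: lookup_mult)
qed

definition algebra_automorphism ::
  "(('g::group_add, 'k::field) group_algebra \<Rightarrow> ('g, 'k) group_algebra) \<Rightarrow> bool"
  where "algebra_automorphism \<alpha> \<longleftrightarrow>
    bij \<alpha> \<and>
    (\<forall>x y. \<alpha> (x + y) = \<alpha> x + \<alpha> y) \<and>
    (\<forall>c x. \<alpha> (c \<cdot> x) = c \<cdot> \<alpha> x) \<and>
    (\<forall>x y. \<alpha> (x * y) = \<alpha> x * \<alpha> y) \<and>
    \<alpha> 1 = 1"

definition left_ideal :: "'a::ring_1 set \<Rightarrow> bool"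
  where "left_ideal I \<longleftrightarrow>
    0 \<in> I \<and> (\<forall>x\<in>I. \<forall>y\<in>I. x + y \<in> I) \<and> (\<forall>r. \<forall>x\<in>I. r * x \<in> I)"

definition minimal_left_ideal :: "'a::ring_1 set \<Rightarrow> bool"
  where "minimal_left_ideal S \<longleftrightarrow>
    left_ideal S \<and> S \<noteq> {0} \<and> (\<forall>I. left_ideal I \<and> I \<subseteq> S \<longrightarrow> I = {0} \<or> I = S)"

text \<open>
  The socle of the left regular module: the sum of all simple left submodules, i.e. the left
  ideal generated by their union.
\<close>

definition socle :: "'a::ring_1 set"
  where "socle = left_ideal hull \<Union> {S. minimal_left_ideal S}"

end

theory Submission
  imports Defs "HOL-Number_Theory.Cong" "HOL-Library.Function_Algebras"
begin

text \<open>
  Let \<open>J\<close> be the augmentation ideal of \<open>kG\<close>. The argument is Jennings' description of the powers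
  of \<open>J\<close>: the associated graded ring of \<open>kG\<close> is the restricted enveloping algebra of a graded
  restricted Lie algebra \<open>L\<close> over \<open>k\<close>. If \<open>x\<^sub>1, \<dots>, x\<^sub>r\<close> is a homogeneous basis of \<open>L\<close>, the ordered
  monomials in the \<open>x\<^sub>i\<close> with exponents below \<open>p\<close> form a basis of the graded ring, and the one of
  highest degree, in which all exponents are \<open>p - 1\<close>, is the sum \<open>n\<close> of the group elements. Since \<open>L\<close>
  is generated in degree one by brackets and \<open>p\<close>-th powers, every automorphism \<open>\<alpha>\<close> of \<open>kG\<close> induces a
  degree-preserving linear map on \<open>L\<close>. It therefore multiplies the top monomial by the
  \<open>(p - 1)\<close>-st power of the determinant of that map. Over the prime field such a power is \<open>1\<close> by
  Fermat.

  The invariance of \<open>L\<close> under \<open>\<alpha>\<close> is the reason for generating the filtration of \<open>G\<close> inductively by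
  commutators and \<open>p\<close>-th powers: \<open>automorphism_dimension_space\<close> is then a rule induction. That \<open>L\<close> is
  closed under \<open>p\<close>-th powers of sums is Jacobson's formula, \<open>jacobson_power_sum\<close>. Nilpotency of \<open>J\<close>
  for a \<open>p\<close>-group, \<open>augmentation_ideal_nilpotent\<close>, makes the filtration reach the trivial group, so
  that \<open>G\<close> is exhausted by successive cyclic extensions; they yield elements \<open>g\<^sub>1, \<dots>, g\<^sub>r\<close> for which
  \<open>x\<^sub>i = g\<^sub>i - 1\<close> spans \<open>L\<close> and \<open>n\<close> is the product of the \<open>x\<^sub>i\<^bsup>p - 1\<^esup>\<close> (\<open>adapted_letters_exist\<close>).

  Interchanging two neighbouring letters of a word in the \<open>x\<^sub>i\<close>, or collecting \<open>p\<close> equal letters,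
  changes it by words of the same degree with fewer letters. In the top degree all these shorter
  words vanish, so there words multiply as in the commutative ring \<open>k[X\<^sub>1, \<dots>, X\<^sub>r]/(X\<^sub>i\<^sup>p)\<close>
  (\<open>word_value_top\<close>). In this commutative ring, a product of \<open>(p - 1)\<close>-st powers of \<open>r\<close> linear forms is a
  \<open>(p - 1)\<close>-st power of a scalar times the top monomial, by Gaussian elimination
  (\<open>linear_forms_power_product\<close>). Applied to the linear forms that describe \<open>\<alpha>\<close> on \<open>L\<close>, this is the
  claim.
\<close>

section \<open>Commutators in characteristic p\<close>

definition commutator :: "'a::ring \<Rightarrow> 'a \<Rightarrow> 'a"
  where "commutator x y = x * y - y * x"

text \<open>
  Left multiplication by \<open>a\<close> and right multiplication by \<open>b\<close> commute as operators, so this is the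
  binomial theorem for their difference. With \<open>a = b\<close> it expands iterated commutators, and with
  \<open>b = u = 1\<close> the powers of \<open>a - 1\<close>.
\<close>

lemma iterated_twisted_commutator:
  fixes a b u :: "'a::ring_1"
  shows "((\<lambda>v. a * v - v * b) ^^ m) u =
    (\<Sum>i\<le>m. of_int ((-1) ^ i * int (m choose i)) * (a ^ (m - i) * u * b ^ i))"
proof -
  define k :: "nat \<Rightarrow> nat \<Rightarrow> 'a" where "k m i = of_int ((-1) ^ i * int (m choose i))" for m i
  have k_left: "a * (k m i * z) = k m i * (a * z)" for m i z
  proof -
    have "a * k m i = k m i * a"
      unfolding k_def by (rule mult_of_int_commute[symmetric])
    then show ?thesis by (simp only: mult.assoc[symmetric])
  qed
  have k_0: "k m 0 = 1" for m by (simp add: k_def)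
  have k_high: "k m (Suc m) = 0" for m by (simp add: k_def binomial_eq_0)
  have pascal: "k (Suc m) (Suc i) = k m (Suc i) - k m i" for m i
  proof -
    have "(-1) ^ Suc i * int (Suc m choose Suc i)
      = (-1) ^ Suc i * int (m choose Suc i) - (-1) ^ i * int (m choose i)"
      by (simp add: algebra_simps)
    then show ?thesis unfolding k_def by (simp only: of_int_diff)
  qed
  have "((\<lambda>v. a * v - v * b) ^^ m) u = (\<Sum>i\<le>m. k m i * (a ^ (m - i) * u * b ^ i))"
  proof (induction m)
    case 0
    show ?case by (simp add: k_0)
  next
    case (Suc m)
    define t where "t i = a ^ (Suc m - i) * u * b ^ i" for i
    define S where "S = (\<Sum>i\<le>m. k m i * (a ^ (m - i) * u * b ^ i))"
    have "a * (k m i * (a ^ (m - i) * u * b ^ i)) = k m i * t i" if "i \<le> m" for i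
      using that by (simp only: k_left t_def Suc_diff_le power_Suc mult.assoc)
    then have "a * S = (\<Sum>i\<le>m. k m i * t i)"
      by (simp add: S_def sum_distrib_left)
    then have left: "a * S = k m 0 * t 0 + (\<Sum>i\<le>m. k m (Suc i) * t (Suc i))"
      using sum.atMost_Suc_shift[of "\<lambda>i. k m i * t i" m] by (simp add: k_high)
    have "k m i * (a ^ (m - i) * u * b ^ i) * b = k m i * t (Suc i)" for i
      by (simp add: t_def mult.assoc flip: power_Suc2)
    then have right: "S * b = (\<Sum>i\<le>m. k m i * t (Suc i))"
      by (simp add: S_def sum_distrib_right)
    have "((\<lambda>v. a * v - v * b) ^^ Suc m) u = a * S - S * b"
      using Suc.IH by (simp add: S_def)
    also have "\<dots> = k m 0 * t 0 + (\<Sum>i\<le>m. k (Suc m) (Suc i) * t (Suc i))"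
      by (simp add: left right pascal left_diff_distrib sum_subtractf)
    also have "\<dots> = (\<Sum>i\<le>Suc m. k (Suc m) i * t i)"
      by (simp only: sum.atMost_Suc_shift k_0)
    finally show ?case by (simp only: t_def)
  qed
  then show ?thesis by (simp only: k_def)
qed

text \<open>
  Neighbouring binomial coefficients \<open>p - 1 choose i\<close> and \<open>p - 1 choose (i + 1)\<close> add up to
  \<open>p choose (i + 1)\<close>, which is divisible by \<open>p\<close>; hence they alternate in sign modulo \<open>p\<close>, starting at \<open>1\<close>.
\<close>

lemma alternating_binomial_char_p:
  assumes p: "prime p" and char: "of_nat p = (0::'a::ring_1)" and "i < p"
  shows "(of_int ((-1) ^ i * int ((p - 1) choose i)) :: 'a) = 1"
  using \<open>i < p\<close>
proof (induction i)
  case 0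
  then show ?case by simp
next
  case (Suc i)
  have "p dvd (p choose Suc i)"
    using p Suc.prems by (intro dvd_choose_prime) auto
  then have z: "of_nat (p choose Suc i) = (0::'a)"
    using char by (auto elim!: dvdE)
  have "p choose Suc i = (p - 1 choose i) + (p - 1 choose Suc i)"
    using p by (metis Suc_diff_1 binomial_Suc_Suc prime_gt_0_nat)
  then have *: "of_nat (p - 1 choose Suc i) = - (of_nat (p - 1 choose i) :: 'a)"
    using z by (simp add: eq_neg_iff_add_eq_0 add.commute)
  have "of_int ((-1) ^ Suc i * int ((p - 1) choose Suc i))
    = (-1) ^ Suc i * (of_nat (p - 1 choose Suc i) :: 'a)"
    by simp
  also have "\<dots> = (-1) ^ i * of_nat (p - 1 choose i)"
    unfolding * by simp
  also have "\<dots> = of_int ((-1) ^ i * int ((p - 1) choose i))" by simp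
  finally show ?case using Suc by simp
qed

lemma iterated_twisted_commutator_char_p:
  fixes a b u :: "'a::ring_1"
  assumes p: "prime p" and char: "of_nat p = (0::'a)"
  shows "((\<lambda>v. a * v - v * b) ^^ (p - 1)) u = (\<Sum>i<p. a ^ (p - 1 - i) * u * b ^ i)"
proof -
  have "{..p - 1} = {..<p}"
    using prime_gt_0_nat[OF p] by auto
  then show ?thesis
    using alternating_binomial_char_p[OF p char] by (simp add: iterated_twisted_commutator)
qed

lemma geometric_sum_char_p:
  fixes y :: "'a::ring_1"
  assumes "prime p" and "of_nat p = (0::'a)"
  shows "(\<Sum>i<p. y ^ i) = (y - 1) ^ (p - 1)"
proof -
  have "((\<lambda>v. y * v - v * 1) ^^ m) 1 = (y - 1) ^ m" for m
    by (induction m) (simp_all add: algebra_simps)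
  then have "(y - 1) ^ (p - 1) = (\<Sum>i<p. y ^ (p - 1 - i))"
    using iterated_twisted_commutator_char_p[OF assms, of y 1 1] by simp
  also have "\<dots> = (\<Sum>i<p. y ^ i)"
    by (subst sum.nat_diff_reindex[symmetric]) simp
  finally show ?thesis by simp
qed

lemma power_minus_one_char_p:
  fixes y :: "'a::ring_1"
  assumes "prime p" and "of_nat p = (0::'a)"
  shows "(y - 1) ^ p = y ^ p - 1"
proof -
  have "p = Suc (p - 1)" using assms(1) prime_gt_0_nat by simp
  then have "(y - 1) ^ p = (y - 1) * (y - 1) ^ (p - 1)"
    by (metis power_Suc)
  also have "\<dots> = y ^ p - 1"
    proof -
    have "(y - 1) * (\<Sum>i<n. y ^ i) = y ^ n - 1" for n
      by (induction n) (simp_all add: algebra_simps)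
    then show ?thesis by (simp only: geometric_sum_char_p[OF assms, symmetric])
  qed
  finally show ?thesis .
qed

lemma uminus_power_char_p:
  fixes x :: "'a::ring_1"
  assumes p: "prime p" and char: "of_nat p = (0::'a)"
  shows "(- x) ^ p = - (x ^ p)"
proof (cases "p = 2")
  case True
  have "of_nat p * x ^ p = 0" by (simp add: char)
  then have "x ^ p + x ^ p = 0" by (simp add: True mult_2)
  then show ?thesis by (simp add: True eq_neg_iff_add_eq_0)
next
  case False
  then have "odd p" using p prime_ge_2_nat[OF p] by (intro prime_odd_nat) auto
  then show ?thesis by simp
qed

lemma inverse_mod_char_p:
  assumes p: "prime p" and char: "of_nat p = (0::'a::ring_1)" and "0 < i" "i < p"
  obtains j where "of_nat (j * i) = (1::'a)"
proof -
  have "coprime i p"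
    using assms by (metis coprime_commute nat_dvd_not_less prime_imp_coprime)
  then obtain j where "[i * j = 1] (mod p)"
    using cong_solve_coprime_nat[of i p] by auto
  then have "i * j mod p = 1"
    using prime_gt_1_nat[OF p] by (simp add: cong_def)
  then have "i * j = p * (i * j div p) + 1"
    by (metis mult_div_mod_eq)
  then have "of_nat (i * j) = (of_nat p * of_nat (i * j div p) + 1 :: 'a)"
    by (metis of_nat_1 of_nat_add of_nat_mult)
  then have "of_nat (j * i) = (1::'a)"
    using char by (simp add: mult.commute)
  then show ?thesis by (rule that)
qed

text \<open>
  The coefficients need not commute, so the derivative of a power keeps one summand for each position
  at which the factor is differentiated. In characteristic \<open>p\<close> and for exponent \<open>p\<close> this sum is an iterated
  commutator, by \<open>iterated_twisted_commutator_char_p\<close>.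
\<close>

lemma fps_deriv_power_noncommutative:
  fixes f :: "'a::ring_1 fps"
  shows "fps_deriv (f ^ m) = (\<Sum>i<m. f ^ (m - 1 - i) * fps_deriv f * f ^ i)"
proof (induction m)
  case 0
  show ?case by simp
next
  case (Suc m)
  have "f * (f ^ (m - 1 - i) * fps_deriv f * f ^ i) = f ^ (m - i) * fps_deriv f * f ^ i"
    if "i < m" for i
  proof -
    have "m - i = Suc (m - 1 - i)" using that by simp
    then show ?thesis by (metis mult.assoc power_Suc)
  qed
  then show ?case by (simp add: Suc sum_distrib_left)
qed

text \<open>
  The formal variable counts occurrences of \<open>x\<close>: coefficient \<open>i\<close> is the sum of all words of length \<open>m\<close>
  with \<open>i\<close> factors \<open>x\<close> and \<open>m - i\<close> factors \<open>y\<close>.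
\<close>

lemma power_nth_linear_fps:
  fixes x y :: "'a::ring_1"
  defines "f \<equiv> fps_const y + fps_X * fps_const x"
  shows "f ^ m $ 0 = y ^ m" and "i > m \<Longrightarrow> f ^ m $ i = 0" and "f ^ m $ m = x ^ m"
    and "(\<Sum>i\<le>m. f ^ m $ i) = (x + y) ^ m"
proof -
  have step: "f ^ Suc m $ i = y * (f ^ m $ i) + (if i = 0 then 0 else x * (f ^ m $ (i - 1)))" for m i
    by (simp add: f_def distrib_right mult.assoc)
  show "f ^ m $ 0 = y ^ m"
    by (induction m) (simp_all add: step del: power_Suc, simp)
  show high: "f ^ m $ i = 0" if "i > m" for m i
    using that by (induction m arbitrary: i) (simp_all add: step del: power_Suc)
  show "f ^ m $ m = x ^ m"
    by (induction m) (simp_all add: step high del: power_Suc, simp)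
  show "(\<Sum>i\<le>m. f ^ m $ i) = (x + y) ^ m"
  proof (induction m)
    case (Suc m)
    have "(\<Sum>i\<le>Suc m. f ^ Suc m $ i) = (\<Sum>i\<le>Suc m. y * (f ^ m $ i)) + (\<Sum>i\<le>m. x * (f ^ m $ i))"
      by (simp add: step sum.distrib sum.atMost_Suc_shift del: power_Suc sum.atMost_Suc)
    also have "\<dots> = y * (x + y) ^ m + x * (x + y) ^ m"
      by (simp add: high Suc flip: sum_distrib_left)
    finally show ?case by (simp add: distrib_right)
  qed simp
qed

lemma sum_mem_additive:
  fixes f :: "'b \<Rightarrow> 'a::comm_monoid_add"
  assumes "0 \<in> S" and "\<And>a b. a \<in> S \<Longrightarrow> b \<in> S \<Longrightarrow> a + b \<in> S" and "\<And>i. i \<in> I \<Longrightarrow> f i \<in> S"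
  shows "sum f I \<in> S"
  using assms(3) by (induction I rule: infinite_finite_induct) (auto intro: assms(1,2))

text \<open>
  Jacobson's formula: the deviation of the Frobenius map from additivity is a sum of iterated
  commutators. Let \<open>f = y + t x\<close>. The derivative of \<open>f\<^sup>p\<close> with respect to \<open>t\<close> is the \<open>(p - 1)\<close>-fold
  commutator of \<open>f\<close> with \<open>x\<close>, so \<open>i\<close> times the \<open>i\<close>-th coefficient of \<open>f\<^sup>p\<close> is a sum of iterated
  commutators in \<open>x\<close> and \<open>y\<close>. For \<open>0 < i < p\<close> the integer \<open>i\<close> can be divided out, and setting \<open>t = 1\<close> gives
  the claim. The sets \<open>S m\<close> stand for the commutators of length \<open>m\<close>, so that the formula can be used in
  any family of subgroups with the right closure properties.
\<close>

theorem jacobson_power_sum: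
  fixes x y :: "'a::ring_1" and S :: "nat \<Rightarrow> 'a set"
  assumes p: "prime p" and char: "of_nat p = (0::'a)"
    and zero: "\<And>m. 0 \<in> S m" and add: "\<And>m a b. a \<in> S m \<Longrightarrow> b \<in> S m \<Longrightarrow> a + b \<in> S m"
    and x: "x \<in> S 1"
    and comm_x: "\<And>m a. m \<ge> 1 \<Longrightarrow> a \<in> S m \<Longrightarrow> commutator x a \<in> S (Suc m)"
    and comm_y: "\<And>m a. m \<ge> 1 \<Longrightarrow> a \<in> S m \<Longrightarrow> commutator y a \<in> S (Suc m)"
  shows "(x + y) ^ p - x ^ p - y ^ p \<in> S p"
proof -
  define f where "f = fps_const y + fps_X * fps_const x"
  note f_power = power_nth_linear_fps[where x = x and y = y, folded f_def]
  have of_nat_mult_mem: "of_nat n * a \<in> S m" if "a \<in> S m" for n m a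
    by (induction n) (auto simp: zero that distrib_right intro: add)
  have char_fps: "of_nat p = (0 :: 'a fps)"
    by (simp add: char flip: fps_of_nat)
  have ad: "((\<lambda>v. f * v - v * f) ^^ m) (fps_const x) $ i \<in> S (Suc m)" for m i
  proof (induction m arbitrary: i)
    case 0
    show ?case using x zero by simp
  next
    case (Suc m)
    define v where "v = ((\<lambda>v. f * v - v * f) ^^ m) (fps_const x)"
    have v: "v $ i \<in> S (Suc m)" for i using Suc by (simp add: v_def)
    have "(f * v - v * f) $ i = commutator y (v $ i)
        + (if i = 0 then 0 else commutator x (v $ (i - 1)))"
    proof -
      have "v * (fps_X * fps_const x) = fps_X * (v * fps_const x)"
        by (metis fps_mult_fps_X_commute mult.assoc)
      then show ?thesis
        by (simp add: f_def commutator_def distrib_right distrib_left mult.assoc)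
    qed
    also have "\<dots> \<in> S (Suc (Suc m))"
      using v by (auto intro!: add comm_x comm_y zero)
    finally show ?case by (simp add: v_def)
  qed
  have "f ^ p $ i \<in> S p" if i: "0 < i" "i < p" for i
  proof -
    have "fps_deriv (f ^ p) = ((\<lambda>v. f * v - v * f) ^^ (p - 1)) (fps_const x)"
      unfolding fps_deriv_power_noncommutative iterated_twisted_commutator_char_p[OF p char_fps]
      by (simp add: f_def)
    then have "fps_deriv (f ^ p) $ (i - 1) \<in> S p"
      using ad[of "p - 1" "i - 1"] prime_gt_0_nat[OF p] by simp
    then have mem: "of_nat i * f ^ p $ i \<in> S p"
      using i by simp
    obtain j where "of_nat (j * i) = (1::'a)"
      using inverse_mod_char_p[OF p char i] .
    then have "of_nat j * (of_nat i * f ^ p $ i) = f ^ p $ i"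
      by (metis mult.assoc mult_1 of_nat_mult)
    then show ?thesis using of_nat_mult_mem[OF mem, of j] by simp
  qed
  then have "(\<Sum>i\<in>{1..<p}. f ^ p $ i) \<in> S p"
    by (intro sum_mem_additive zero add) auto
  moreover have "(x + y) ^ p = y ^ p + (\<Sum>i\<in>{1..<p}. f ^ p $ i) + x ^ p"
  proof -
    obtain q where q: "p = Suc q"
      using prime_gt_0_nat[OF p] gr0_implies_Suc by blast
    have "{..p} = insert 0 (insert p {1..<p})"
      using q by auto
    then show ?thesis
      using f_power(1,3) q by (simp add: add.assoc add.commute del: power_Suc flip: f_power(4))
  qed
  ultimately show ?thesis by (simp add: algebra_simps)
qed

section \<open>Powers of an ideal\<close>

definition additive_subgroup :: "'a::ab_group_add set \<Rightarrow> bool"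
  where "additive_subgroup S \<longleftrightarrow> 0 \<in> S \<and> (\<forall>x\<in>S. \<forall>y\<in>S. x - y \<in> S)"

lemma additive_subgroup_zero: "additive_subgroup S \<Longrightarrow> 0 \<in> S"
  and additive_subgroup_diff: "additive_subgroup S \<Longrightarrow> x \<in> S \<Longrightarrow> y \<in> S \<Longrightarrow> x - y \<in> S"
  by (auto simp: additive_subgroup_def)

lemma additive_subgroup_uminus: "additive_subgroup S \<Longrightarrow> x \<in> S \<Longrightarrow> - x \<in> S"
  using additive_subgroup_diff[of S 0 x] by (simp add: additive_subgroup_zero)

lemma additive_subgroup_add: "additive_subgroup S \<Longrightarrow> x \<in> S \<Longrightarrow> y \<in> S \<Longrightarrow> x + y \<in> S"
  using additive_subgroup_diff[of S x "- y"] by (simp add: additive_subgroup_uminus)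

lemma additive_subgroup_sum:
  "additive_subgroup S \<Longrightarrow> (\<And>i. i \<in> I \<Longrightarrow> f i \<in> S) \<Longrightarrow> sum f I \<in> S"
  by (rule sum_mem_additive) (auto intro: additive_subgroup_zero additive_subgroup_add)

lemma additive_subgroup_hull: "additive_subgroup (additive_subgroup hull S)"
  by (rule hull_in) (auto simp: additive_subgroup_def)

definition two_sided_ideal :: "'a::ring_1 set \<Rightarrow> bool"
  where "two_sided_ideal J \<longleftrightarrow>
    additive_subgroup J \<and> (\<forall>r. \<forall>x\<in>J. r * x \<in> J) \<and> (\<forall>r. \<forall>x\<in>J. x * r \<in> J)"

primrec ideal_power :: "'a::ring_1 set \<Rightarrow> nat \<Rightarrow> 'a set" where
  "ideal_power J 0 = UNIV"
| "ideal_power J (Suc n) = additive_subgroup hull {x * y | x y. x \<in> ideal_power J n \<and> y \<in> J}"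

declare ideal_power.simps(2) [simp del]

lemma additive_subgroup_ideal_power: "additive_subgroup (ideal_power J n)"
  by (cases n) (simp_all add: ideal_power.simps(2) additive_subgroup_hull, simp add: additive_subgroup_def)

lemma ideal_power_Suc_induct [consumes 1, case_names mult zero diff]:
  assumes "x \<in> ideal_power J (Suc n)"
    and "\<And>x y. x \<in> ideal_power J n \<Longrightarrow> y \<in> J \<Longrightarrow> P (x * y)"
    and "P 0" and "\<And>x y. P x \<Longrightarrow> P y \<Longrightarrow> P (x - y)"
  shows "P x"
proof -
  have "x \<in> additive_subgroup hull {x * y | x y. x \<in> ideal_power J n \<and> y \<in> J}"
    using assms(1) by (simp add: ideal_power.simps(2))
  then show ?thesis
    by (rule hull_induct) (use assms in \<open>auto simp: additive_subgroup_def\<close>)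
qed

lemma ideal_power_SucI: "x \<in> ideal_power J n \<Longrightarrow> y \<in> J \<Longrightarrow> x * y \<in> ideal_power J (Suc n)"
  by (auto simp: ideal_power.simps(2) intro!: hull_inc)

lemma ideal_power_left: "x \<in> ideal_power J n \<Longrightarrow> r * x \<in> ideal_power J n"
proof (induction n arbitrary: r x)
  case (Suc n)
  from Suc.prems show ?case
    by (induction rule: ideal_power_Suc_induct)
      (auto simp: right_diff_distrib simp flip: mult.assoc
        intro: Suc.IH ideal_power_SucI additive_subgroup_zero additive_subgroup_diff
          additive_subgroup_ideal_power)
qed simp

lemma ideal_power_right:
  assumes J: "two_sided_ideal J" and x: "x \<in> ideal_power J n"
  shows "x * r \<in> ideal_power J n"
proof (cases n)
  case (Suc k)
  from x show ?thesis unfolding Suc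
  proof (induction rule: ideal_power_Suc_induct)
    case (mult x y)
    then have "y * r \<in> J" using J by (simp add: two_sided_ideal_def)
    with mult show ?case
      by (simp only: mult.assoc ideal_power_SucI)
  next
    case zero
    then show ?case
      by (simp add: additive_subgroup_zero additive_subgroup_ideal_power)
  next
    case (diff x y)
    then show ?case
      by (simp add: left_diff_distrib additive_subgroup_diff additive_subgroup_ideal_power)
  qed
qed simp

lemma ideal_power_mult:
  assumes J: "two_sided_ideal J" and "x \<in> ideal_power J m" and "y \<in> ideal_power J n"
  shows "x * y \<in> ideal_power J (m + n)"
  using assms(2,3)
proof (induction n arbitrary: y)
  case 0
  then show ?case using ideal_power_right[OF J] by simp
next
  case (Suc n)
  from Suc.prems(2) show ?case unfolding add_Suc_right
  proof (induction rule: ideal_power_Suc_induct)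
    case (mult a b)
    then show ?case
      using Suc.IH[OF Suc.prems(1)] by (simp only: mult.assoc[symmetric] ideal_power_SucI)
  next
    case zero
    then show ?case
      by (simp add: additive_subgroup_zero additive_subgroup_ideal_power)
  next
    case (diff x y)
    then show ?case
      by (simp add: right_diff_distrib additive_subgroup_diff additive_subgroup_ideal_power)
  qed
qed

lemma ideal_power_one:
  assumes J: "two_sided_ideal J"
  shows "ideal_power J 1 = J"
proof
  show "ideal_power J 1 \<subseteq> J"
  proof
    fix x assume "x \<in> ideal_power J 1"
    then have "x \<in> ideal_power J (Suc 0)" by simp
    then show "x \<in> J"
      by (induction rule: ideal_power_Suc_induct)
        (use J in \<open>auto simp: two_sided_ideal_def intro: additive_subgroup_zero additive_subgroup_diff\<close>)
  qed
  show "J \<subseteq> ideal_power J 1"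
    using ideal_power_SucI[of 1 J 0] by auto
qed

lemma ideal_power_antimono:
  assumes J: "two_sided_ideal J" and "m \<le> n"
  shows "ideal_power J n \<subseteq> ideal_power J m"
proof -
  have "x \<in> ideal_power J (m + k) \<Longrightarrow> x \<in> ideal_power J m" for k x
  proof (induction k arbitrary: x)
    case (Suc k)
    from Suc.prems have "x \<in> ideal_power J (Suc (m + k))" by simp
    then show ?case
      by (induction rule: ideal_power_Suc_induct)
        (auto intro: Suc.IH ideal_power_right[OF J] additive_subgroup_zero additive_subgroup_diff
          additive_subgroup_ideal_power)
  qed simp
  then show ?thesis using assms(2) by (metis le_Suc_ex subsetI)
qed

lemma ideal_power_power:
  assumes J: "two_sided_ideal J" and "x \<in> ideal_power J n"
  shows "x ^ k \<in> ideal_power J (k * n)"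
  using ideal_power_mult[OF J assms(2)] by (induction k) auto

section \<open>The group algebra and its augmentation ideal\<close>

interpretation group_algebra: vector_space
  "scale :: 'k::field \<Rightarrow> ('g, 'k) group_algebra \<Rightarrow> ('g, 'k) group_algebra"
  by (rule vector_space_scale)

abbreviation grp :: "'g::group_add \<Rightarrow> ('g, 'k::field) group_algebra"
  where "grp g \<equiv> Poly_Mapping.single g 1"

lemma scale_eq_mult_left: "c \<cdot> x = Poly_Mapping.single 0 c * (x :: ('g::group_add, 'k::field) group_algebra)"
  unfolding scale_def by (rule mult_map_scale_conv_mult)

lemma scale_mult_left: "(c \<cdot> x) * y = c \<cdot> (x * (y :: ('g::group_add, 'k::field) group_algebra))"
  by (simp add: scale_eq_mult_left mult.assoc)

lemma grp_add: "grp (g + h) = grp g * (grp h :: ('g::group_add, 'k::field) group_algebra)"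
  by (simp add: mult_single)

lemma grp_uminus_right [simp]: "grp g * grp (- g) = (1 :: ('g::group_add, 'k::field) group_algebra)"
  and grp_uminus_left [simp]: "grp (- g) * grp g = (1 :: ('g::group_add, 'k::field) group_algebra)"
  by (simp_all flip: grp_add)

lemma group_algebra_expansion:
  "x = (\<Sum>g\<in>UNIV. Poly_Mapping.lookup x g \<cdot> (grp g :: ('g::{finite, group_add}, 'k::field) group_algebra))"
  by (rule poly_mapping_eqI) (simp add: lookup_sum lookup_scale lookup_single when_def mult_delta_right)

lemma lookup_grp_mult:
  "Poly_Mapping.lookup (grp g * x) h
    = Poly_Mapping.lookup (x :: ('g::{finite, group_add}, 'k::field) group_algebra) (- g + h)"
  by (simp add: lookup_times_group_algebra lookup_single when_def mult_delta_left)

lemma scale_mult_right: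
  "x * (c \<cdot> y) = c \<cdot> (x * (y :: ('g::{finite, group_add}, 'k::field) group_algebra))"
  by (rule poly_mapping_eqI)
    (simp add: lookup_times_group_algebra lookup_scale sum_distrib_left mult.left_commute)

lemma scale_power: "(c \<cdot> x) ^ n = c ^ n \<cdot> (x :: ('g::{finite, group_add}, 'k::field) group_algebra) ^ n"
  by (induction n) (simp_all add: scale_mult_left scale_mult_right)

lemma of_nat_group_algebra:
  "of_nat p = (0::'k::field) \<Longrightarrow> of_nat p = (0 :: ('g::group_add, 'k) group_algebra)"
  by (metis single_of_nat single_zero)

definition augmentation :: "('g::{finite, group_add}, 'k::field) group_algebra \<Rightarrow> 'k"
  where "augmentation x = (\<Sum>g\<in>UNIV. Poly_Mapping.lookup x g)"

lemma augmentation_diff: "augmentation (x - y) = augmentation x - augmentation y"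
  by (simp add: augmentation_def lookup_minus sum_subtractf)

lemma augmentation_zero [simp]: "augmentation 0 = 0"
  by (simp add: augmentation_def)

lemma augmentation_grp [simp]: "augmentation (grp g) = 1"
  by (simp add: augmentation_def lookup_single when_def)

lemma augmentation_one [simp]: "augmentation 1 = 1"
  using augmentation_grp[of 0] by simp

lemma augmentation_scale: "augmentation (c \<cdot> x) = c * augmentation x"
  by (simp add: augmentation_def lookup_scale sum_distrib_left)

lemma augmentation_mult: "augmentation (x * y) = augmentation x * augmentation y"
proof -
  have shift: "(\<Sum>g\<in>UNIV. Poly_Mapping.lookup y (- h + g)) = augmentation y" for h
    unfolding augmentation_def
    by (rule sum.reindex_bij_witness[of _ "\<lambda>g. h + g" "\<lambda>g. - h + g"])
      (simp_all flip: add.assoc)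
  have "augmentation (x * y) = (\<Sum>h\<in>UNIV. \<Sum>g\<in>UNIV.
      Poly_Mapping.lookup x h * Poly_Mapping.lookup y (- h + g))"
    unfolding augmentation_def lookup_times_group_algebra by (rule sum.swap)
  then show ?thesis
    by (simp add: shift flip: sum_distrib_left sum_distrib_right)
      (simp add: augmentation_def)
qed

lemma augmentation_power: "augmentation (x ^ n) = augmentation x ^ n"
  by (induction n) (simp_all add: augmentation_mult)

definition augmentation_ideal :: "('g::{finite, group_add}, 'k::field) group_algebra set"
  where "augmentation_ideal = {x. augmentation x = 0}"

lemma two_sided_augmentation_ideal: "two_sided_ideal augmentation_ideal"
  by (simp add: two_sided_ideal_def additive_subgroup_def augmentation_ideal_def
      augmentation_diff augmentation_mult)

lemma grp_minus_one_mem: "grp g - 1 \<in> augmentation_ideal"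
  by (simp add: augmentation_ideal_def augmentation_diff)

lemma augmentation_ideal_expansion:
  fixes x :: "('g::{finite, group_add}, 'k::field) group_algebra"
  assumes "x \<in> augmentation_ideal"
  shows "x = (\<Sum>g\<in>UNIV. Poly_Mapping.lookup x g \<cdot> (grp g - 1))"
proof -
  have "(\<Sum>g\<in>UNIV. Poly_Mapping.lookup x g \<cdot> (grp g - 1))
    = (\<Sum>g\<in>UNIV. Poly_Mapping.lookup x g \<cdot> grp g)
      - (\<Sum>g\<in>UNIV. Poly_Mapping.lookup x g) \<cdot> (1 :: ('g, 'k) group_algebra)"
    by (simp add: group_algebra.scale_right_diff_distrib sum_subtractf
        group_algebra.scale_sum_left)
  then show ?thesis
    using assms group_algebra_expansion[of x]
    by (simp add: augmentation_ideal_def augmentation_def)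
qed

section \<open>Nilpotency of the augmentation ideal of a p-group\<close>

text \<open>
  The fibres of \<open>g \<mapsto> g \<cdot> s\<close> over the orbit are translates of the stabilizer of \<open>s\<close>.
\<close>

lemma card_orbit_dvd:
  fixes act :: "'g::{finite, group_add} \<Rightarrow> 'b \<Rightarrow> 'b"
  assumes act_0: "act 0 s = s" and act_add: "\<And>g h. act (g + h) s = act g (act h s)"
  shows "card (range (\<lambda>g. act g s)) dvd CARD('g)"
proof -
  let ?fibre = "\<lambda>t. {g. act g s = t}"
  have fibre: "card (?fibre (act h s)) = card (?fibre s)" for h
  proof (rule bij_betw_same_card[OF bij_betw_byWitness[where f = "\<lambda>g. - h + g" and f' = "\<lambda>g. h + g"]])
    have "act (- h + g) s = s" if "act g s = act h s" for g
      using that act_0 by (metis act_add add.left_inverse)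
    then show "(\<lambda>g. - h + g) ` ?fibre (act h s) \<subseteq> ?fibre s" by auto
    show "(\<lambda>g. h + g) ` ?fibre s \<subseteq> ?fibre (act h s)"
      by (auto simp: act_add)
  qed (simp_all flip: add.assoc)
  have "(\<Union>t\<in>range (\<lambda>g. act g s). ?fibre t) = UNIV" by auto
  moreover have "card (\<Union>t\<in>range (\<lambda>g. act g s). ?fibre t)
      = (\<Sum>t\<in>range (\<lambda>g. act g s). card (?fibre t))"
    by (rule card_UN_disjoint) auto
  ultimately have "CARD('g) = (\<Sum>t\<in>range (\<lambda>g. act g s). card (?fibre t))"
    by simp
  also have "\<dots> = (\<Sum>t\<in>range (\<lambda>g. act g s). card (?fibre s))"
    by (rule sum.cong) (auto simp: fibre)
  finally show ?thesis by simp
qed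

text \<open>
  Orbits of a \<open>p\<close>-group that are not fixed points have size divisible by \<open>p\<close>, so the number of fixed
  points is divisible by \<open>p\<close>; it is not \<open>0\<close> because of \<open>z\<close>.
\<close>

lemma p_group_second_fixed_point:
  fixes act :: "'g::{finite, group_add} \<Rightarrow> 'b \<Rightarrow> 'b"
  assumes p: "prime p" and card: "CARD('g) = p ^ m" and fin: "finite S" and dvd: "p dvd card S"
    and closed: "\<And>g s. s \<in> S \<Longrightarrow> act g s \<in> S"
    and act_0: "\<And>s. s \<in> S \<Longrightarrow> act 0 s = s"
    and act_add: "\<And>g h s. s \<in> S \<Longrightarrow> act (g + h) s = act g (act h s)"
    and z: "z \<in> S" "\<And>g. act g z = z"
  obtains s where "s \<in> S" and "s \<noteq> z" and "\<And>g. act g s = s"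
proof (rule ccontr)
  note fixed = that
  assume "\<not> thesis"
  then have moved: "\<exists>g. act g s \<noteq> s" if "s \<in> S - {z}" for s
    using that fixed by blast
  define orbit where "orbit s = range (\<lambda>g. act g s)" for s
  have self: "s \<in> orbit s" if "s \<in> S" for s
    using act_0[OF that] by (metis orbit_def rangeI)
  have act_back: "act (- g) (act g s) = s" if "s \<in> S" for g s
    using act_add[OF that, of "- g" g] act_0[OF that] by simp
  have sub: "orbit s \<subseteq> S - {z}" if "s \<in> S - {z}" for s
    using that closed z(2) act_back by (auto simp: orbit_def) metis
  have same: "orbit t = orbit s" if "s \<in> S" "t \<in> orbit s" for s t
  proof -
    obtain h where t: "t = act h s" using \<open>t \<in> orbit s\<close> by (auto simp: orbit_def)
    have "act g t = act (g + h) s" for g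
      using act_add[OF \<open>s \<in> S\<close>] t by simp
    moreover have "act g s = act (g - h) t" for g
      using act_add[OF \<open>s \<in> S\<close>, of "g - h" h] t by simp
    ultimately show ?thesis unfolding orbit_def by blast
  qed
  have orbit_dvd: "p dvd card (orbit s)" if s: "s \<in> S - {z}" for s
  proof -
    have "card (orbit s) dvd p ^ m"
      unfolding orbit_def card[symmetric]
      by (rule card_orbit_dvd) (use s act_0 act_add in auto)
    moreover have "card (orbit s) \<noteq> 1"
    proof
      assume "card (orbit s) = 1"
      then obtain t where "orbit s = {t}" by (rule card_1_singletonE)
      then have "orbit s = {s}" using self[of s] s by auto
      then show False using moved[OF s] by (auto simp: orbit_def)
    qed
    ultimately show ?thesis
      using p by (metis divides_primepow_nat dvd_power gcd_nat.extremum neq0_conv power_0)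
  qed
  have "\<Union> (orbit ` (S - {z})) = S - {z}"
    using self sub by blast
  moreover have "p dvd card (\<Union> (orbit ` (S - {z})))"
  proof (rule dvd_partition)
    show "finite (\<Union> (orbit ` (S - {z})))" using calculation fin by simp
    show "\<forall>c\<in>orbit ` (S - {z}). p dvd card c" using orbit_dvd by auto
    have "orbit s = orbit t" if "s \<in> S" "t \<in> S" "u \<in> orbit s" "u \<in> orbit t" for s t u
      using same[of s u] same[of t u] that by simp
    then show "\<forall>c1\<in>orbit ` (S - {z}). \<forall>c2\<in>orbit ` (S - {z}). c1 \<noteq> c2 \<longrightarrow> c1 \<inter> c2 = {}"
      by blast
  qed
  ultimately have "p dvd card (S - {z})" by simp
  moreover have "card S = Suc (card (S - {z}))"
    using fin z(1) by (metis card.remove)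
  ultimately have "p dvd 1"
    using dvd by (metis Suc_eq_plus1 dvd_add_right_iff)
  then show False using p by (simp add: not_prime_unit)
qed

text \<open>
  The set is a union of cosets of the group of multiples of \<open>v\<close>, which has order \<open>p\<close>.
\<close>

lemma char_p_dvd_card:
  fixes S :: "'a::ring_1 set"
  assumes p: "prime p" and char: "of_nat p = (0::'a)" and fin: "finite S"
    and S: "additive_subgroup S" and v: "v \<in> S" "v \<noteq> 0"
  shows "p dvd card S"
proof -
  define coset where "coset s = range (\<lambda>i. s + of_nat i * v)" for s
  have reduce: "of_nat i * v = of_nat (i mod p) * v" for i
  proof -
    have "(of_nat i :: 'a) = of_nat (p * (i div p) + i mod p)" by simp
    also have "\<dots> = of_nat (i mod p)"
      unfolding of_nat_add of_nat_mult char by simp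
    finally show ?thesis by simp
  qed
  have neg: "of_nat ((p - 1) * i) * v = - (of_nat i * v)" for i
  proof -
    have "of_nat ((p - 1) * i) + of_nat i = (of_nat (p * i) :: 'a)"
      using prime_gt_0_nat[OF p] by (simp add: algebra_simps flip: of_nat_add of_nat_mult)
    then have "of_nat ((p - 1) * i) + of_nat i = (0 :: 'a)"
      by (simp only: of_nat_mult char mult_zero_left)
    then have "of_nat ((p - 1) * i) = - (of_nat i :: 'a)"
      by (rule eq_neg_iff_add_eq_0[THEN iffD2])
    then show ?thesis by simp
  qed
  have multiple: "of_nat i * v \<in> S" for i
    by (induction i) (auto simp: distrib_right intro: v S additive_subgroup_zero additive_subgroup_add)
  have "card (coset s) = p" for s
  proof -
    have "coset s = (\<lambda>i. s + of_nat i * v) ` {..<p}"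
    proof -
      have "s + of_nat i * v \<in> (\<lambda>i. s + of_nat i * v) ` {..<p}" for i
        using reduce[of i] prime_gt_0_nat[OF p] by auto
      then show ?thesis unfolding coset_def by blast
    qed
    moreover have "inj_on (\<lambda>i. s + of_nat i * v) {..<p}"
    proof (rule linorder_inj_onI)
      fix i j assume ij: "i < j" "i \<in> {..<p}" "j \<in> {..<p}"
      obtain l where l: "of_nat (l * (j - i)) = (1::'a)"
        using inverse_mod_char_p[OF p char, of "j - i"] ij by (metis less_imp_diff_less lessThan_iff zero_less_diff)
      show "s + of_nat i * v \<noteq> s + of_nat j * v"
      proof
        assume "s + of_nat i * v = s + of_nat j * v"
        then have "of_nat (j - i) * v = 0"
          using ij by (simp add: of_nat_diff left_diff_distrib)
        then have "of_nat (l * (j - i)) * v = 0" by (simp add: mult.assoc)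
        then show False using l v(2) by simp
      qed
    qed auto
    ultimately show ?thesis by (simp add: card_image)
  qed
  moreover have "\<Union> (coset ` S) = S"
  proof
    show "\<Union> (coset ` S) \<subseteq> S"
      using multiple S by (auto simp: coset_def intro: additive_subgroup_add)
    have "s \<in> coset s" for s
      unfolding coset_def by (rule range_eqI[of _ _ 0]) simp
    then show "S \<subseteq> \<Union> (coset ` S)" by blast
  qed
  moreover have "coset s = coset t" if "u \<in> coset s" "u \<in> coset t" for s t u
  proof -
    have "coset s \<subseteq> coset t" if "u \<in> coset s" "u \<in> coset t" for s t
    proof -
      obtain i j where "u = s + of_nat i * v" "u = t + of_nat j * v"
        using \<open>u \<in> coset s\<close> \<open>u \<in> coset t\<close> unfolding coset_def by blast
      then have "s = t + of_nat j * v + of_nat ((p - 1) * i) * v"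
        unfolding neg by (simp add: algebra_simps)
      then have "s + of_nat l * v = t + of_nat (j + (p - 1) * i + l) * v" for l
        by (simp only: of_nat_add distrib_right add.assoc)
      then show ?thesis unfolding coset_def by blast
    qed
    then show ?thesis using that by blast
  qed
  ultimately show ?thesis
    using dvd_partition[of "coset ` S" p] fin by (simp, blast)
qed

text \<open>
  The group ring \<open>F\<close> over the prime field is finite and contains \<open>1\<close>. Let \<open>A i\<close> be the set of elements of
  \<open>F\<close> that \<open>J\<^sup>i\<close> annihilates from the left. If \<open>J\<^sup>i \<noteq> 0\<close>, then \<open>F / A i\<close> is a nonzero finite
  group of exponent \<open>p\<close> on which the \<open>p\<close>-group \<open>G\<close> acts, so it has a nonzero fixed point. A representative
  \<open>y\<close> of it satisfies \<open>J y \<subseteq> A i\<close>, which puts it in \<open>A (i + 1)\<close>. Thus the \<open>A i\<close> would grow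
  strictly for ever if no power of \<open>J\<close> vanished, which is impossible in a finite set. The quotient \<open>F / A i\<close> is
  realized by letting \<open>y\<close> act on \<open>J\<^sup>i\<close> by right multiplication.
\<close>

theorem augmentation_ideal_nilpotent:
  assumes p: "prime p" and card: "CARD('g::{finite, group_add}) = p ^ m"
    and char: "of_nat p = (0::'k::field)"
  obtains K where "ideal_power (augmentation_ideal :: ('g, 'k) group_algebra set) K = {0}"
proof (rule ccontr)
  assume not_nilpotent: "\<not> thesis"
  let ?J = "augmentation_ideal :: ('g, 'k) group_algebra set"
  note J = two_sided_augmentation_ideal
  have one: "\<exists>u\<in>ideal_power ?J i. u \<noteq> 0" for i
    using not_nilpotent that[of i] additive_subgroup_zero[OF additive_subgroup_ideal_power, of ?J i]
    by blast
  define P where "P = (of_nat ` {..<p} :: 'k set)"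
  have P_nat: "of_nat i \<in> P" for i
  proof -
    have "(of_nat i :: 'k) = of_nat (p * (i div p) + i mod p)" by simp
    also have "\<dots> = of_nat (i mod p)"
      unfolding of_nat_add of_nat_mult char by simp
    finally show ?thesis
      using prime_gt_0_nat[OF p] by (auto simp: P_def)
  qed
  have P_diff: "a - b \<in> P" if "a \<in> P" "b \<in> P" for a b
  proof -
    obtain i j where ij: "a = of_nat i" "b = of_nat j" "j < p"
      using \<open>a \<in> P\<close> \<open>b \<in> P\<close> by (auto simp: P_def)
    then have "a - b = of_nat (i + (p - j))"
      by (simp add: of_nat_diff char)
    then show ?thesis by (simp only: P_nat)
  qed
  define F where "F = {x :: ('g, 'k) group_algebra. \<forall>g. Poly_Mapping.lookup x g \<in> P}"
  have "finite F"
  proof (rule finite_imageD)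
    have "Poly_Mapping.lookup ` F \<subseteq> {f. \<forall>g. (g \<in> UNIV \<longrightarrow> f g \<in> P) \<and> (g \<notin> UNIV \<longrightarrow> f g = 0)}"
      by (auto simp: F_def)
    then show "finite (Poly_Mapping.lookup ` F)"
      by (rule finite_subset) (rule finite_set_of_finite_funs, simp_all add: P_def)
    show "inj_on Poly_Mapping.lookup F"
      by (rule inj_onI) (rule poly_mapping_eq_iff[THEN iffD2])
  qed
  have F: "additive_subgroup F"
    using P_diff P_nat[of 0] by (simp add: F_def additive_subgroup_def lookup_minus)
  have F_grp: "grp g * x \<in> F" if "x \<in> F" for g x
    using that by (simp add: F_def lookup_grp_mult)
  have F_one: "1 \<in> F"
    using P_nat[of 0] P_nat[of 1] by (simp add: F_def lookup_one when_def)
  define A where "A i = {y \<in> F. \<forall>u\<in>ideal_power ?J i. u * y = 0}" for i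
  have A_less: "A i \<subset> A (Suc i)" for i
  proof -
    define \<Psi> where "\<Psi> y = (\<lambda>u. if u \<in> ideal_power ?J i then u * y else 0)" for y
    define act where "act g f = (\<lambda>u. f (u * grp g))" for g and f :: "('g, 'k) group_algebra \<Rightarrow> ('g, 'k) group_algebra"
    have stable: "u * grp g \<in> ideal_power ?J i \<longleftrightarrow> u \<in> ideal_power ?J i" for u g
    proof
      assume "u * grp g \<in> ideal_power ?J i"
      then have "u * grp g * grp (- g) \<in> ideal_power ?J i" by (rule ideal_power_right[OF J])
      then show "u \<in> ideal_power ?J i" by (simp add: mult.assoc)
    qed (rule ideal_power_right[OF J])
    have act_\<Psi>: "act g (\<Psi> y) = \<Psi> (grp g * y)" for g y
      by (auto simp: act_def \<Psi>_def stable mult.assoc)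
    have \<Psi>_zero: "\<Psi> 0 = 0" by (auto simp: \<Psi>_def)
    have \<Psi>_diff: "\<Psi> x - \<Psi> y = \<Psi> (x - y)" for x y
      by (auto simp: \<Psi>_def right_diff_distrib)
    have "additive_subgroup (\<Psi> ` F)"
      using F \<Psi>_zero by (auto simp: additive_subgroup_def \<Psi>_diff image_iff)
    moreover have "\<Psi> 1 \<in> \<Psi> ` F" using F_one by blast
    moreover have "\<Psi> 1 \<noteq> 0" using one[of i] by (auto simp: \<Psi>_def fun_eq_iff)
    moreover have "of_nat p = (0 :: ('g, 'k) group_algebra \<Rightarrow> ('g, 'k) group_algebra)"
      by (simp add: fun_eq_iff of_nat_fun of_nat_group_algebra[OF char])
    ultimately have "p dvd card (\<Psi> ` F)"
      using char_p_dvd_card[OF p, of "\<Psi> ` F" "\<Psi> 1"] \<open>finite F\<close> by simp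
    then obtain f where f: "f \<in> \<Psi> ` F" "f \<noteq> 0" "\<And>g. act g f = f"
    proof (rule p_group_second_fixed_point[OF p card finite_imageI[OF \<open>finite F\<close>]])
      show "act g f \<in> \<Psi> ` F" if "f \<in> \<Psi> ` F" for g f
        using that F_grp by (auto simp: act_\<Psi>)
      show "act (g + h) f = act g (act h f)" for g h f
        by (simp add: act_def grp_add mult.assoc)
      show "0 \<in> \<Psi> ` F"
        using \<Psi>_zero additive_subgroup_zero[OF F] by (metis imageI)
    qed (auto simp: act_def)
    then obtain y where y: "y \<in> F" "\<Psi> y \<noteq> 0" "\<And>g. \<Psi> (grp g * y) = \<Psi> y"
      by (auto simp: act_\<Psi>)
    have kill: "u * (grp g - 1) * y = 0" if "u \<in> ideal_power ?J i" for u g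
      using fun_cong[OF y(3)[of g], of u] that
      by (simp add: \<Psi>_def mult.assoc right_diff_distrib left_diff_distrib)
    have kill_ideal: "u * v * y = 0" if u: "u \<in> ideal_power ?J i" and v: "v \<in> ?J" for u v
    proof -
      have "u * v * y = u * (\<Sum>g\<in>UNIV. Poly_Mapping.lookup v g \<cdot> (grp g - 1)) * y"
        using augmentation_ideal_expansion[OF v] by simp
      also have "\<dots> = (\<Sum>g\<in>UNIV. Poly_Mapping.lookup v g \<cdot> (u * (grp g - 1) * y))"
        by (simp add: sum_distrib_left sum_distrib_right scale_mult_left scale_mult_right)
      also have "\<dots> = 0" by (simp add: kill[OF u])
      finally show ?thesis .
    qed
    have "w * y = 0" if "w \<in> ideal_power ?J (Suc i)" for w
      using that
      by (induction rule: ideal_power_Suc_induct) (auto simp: left_diff_distrib kill_ideal)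
    then have "y \<in> A (Suc i)" using y(1) by (simp add: A_def)
    moreover have "y \<notin> A i" using y(2) by (auto simp: A_def \<Psi>_def fun_eq_iff split: if_splits)
    moreover have "A i \<subseteq> A (Suc i)"
      using ideal_power_antimono[OF J, of i "Suc i"] by (auto simp: A_def)
    ultimately show ?thesis by blast
  qed
  have A_fin: "finite (A i)" for i
    using \<open>finite F\<close> by (simp add: A_def)
  have "card (A i) \<ge> i" for i
  proof (induction i)
    case (Suc i)
    then show ?case using psubset_card_mono[OF A_fin A_less[of i]] by simp
  qed simp
  moreover have "card (A i) \<le> card F" for i
    using \<open>finite F\<close> by (intro card_mono) (auto simp: A_def)
  ultimately show False
    by (meson Suc_n_not_le_n le_trans)
qed

section \<open>The dimension filtration and its Lie algebra\<close>

abbreviation aug_power :: "nat \<Rightarrow> ('g::{finite, group_add}, 'k::field) group_algebra set"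
  where "aug_power \<equiv> ideal_power augmentation_ideal"

lemmas aug_power_subgroup = additive_subgroup_ideal_power[of augmentation_ideal]
  and aug_power_left = ideal_power_left[where J = augmentation_ideal]
  and aug_power_right = ideal_power_right[OF two_sided_augmentation_ideal]
  and aug_power_mult = ideal_power_mult[OF two_sided_augmentation_ideal]
  and aug_power_one = ideal_power_one[OF two_sided_augmentation_ideal]
  and aug_power_antimono = ideal_power_antimono[OF two_sided_augmentation_ideal]
  and aug_power_power = ideal_power_power[OF two_sided_augmentation_ideal]

lemma aug_power_scale: "x \<in> aug_power n \<Longrightarrow> c \<cdot> x \<in> aug_power n"
  by (simp only: scale_eq_mult_left aug_power_left)

lemma aug_power_mult_aug: "x \<in> aug_power n \<Longrightarrow> y \<in> augmentation_ideal \<Longrightarrow> x * y \<in> aug_power (Suc n)"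
  by (rule ideal_power_SucI)

definition multiple :: "nat \<Rightarrow> 'g::group_add \<Rightarrow> 'g"
  where "multiple n g = ((+) g ^^ n) 0"

lemma multiple_0 [simp]: "multiple 0 g = 0"
  and multiple_Suc [simp]: "multiple (Suc n) g = g + multiple n g"
  by (simp_all add: multiple_def)

lemma multiple_add: "multiple (m + n) g = multiple m g + multiple n g"
  by (induction m) (simp_all add: add.assoc)

lemma multiple_mult: "multiple (m * n) g = multiple m (multiple n g)"
  by (induction m) (simp_all add: multiple_add)

lemma grp_multiple: "grp (multiple n g) = (grp g :: ('g::group_add, 'k::field) group_algebra) ^ n"
  by (induction n) (simp_all add: grp_add)

text \<open>
  The smallest descending filtration of the group, starting with the whole group in degree \<open>1\<close>, that is
  compatible with commutators and \<open>p\<close>-th powers (the Zassenhaus filtration). Additive notation is used for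
  the group, so \<open>g + h - g - h\<close> is a group commutator and \<open>multiple p g\<close> a \<open>p\<close>-th power.
\<close>

inductive dimension_filtration :: "nat \<Rightarrow> nat \<Rightarrow> 'g::group_add \<Rightarrow> bool" for p where
  whole: "dimension_filtration p 1 g"
| zero: "n \<ge> 1 \<Longrightarrow> dimension_filtration p n 0"
| add: "dimension_filtration p n g \<Longrightarrow> dimension_filtration p n h \<Longrightarrow> dimension_filtration p n (g + h)"
| uminus: "dimension_filtration p n g \<Longrightarrow> dimension_filtration p n (- g)"
| commutator: "dimension_filtration p i g \<Longrightarrow> dimension_filtration p j h \<Longrightarrow>
    dimension_filtration p (i + j) (g + h - g - h)"
| multiple: "dimension_filtration p n g \<Longrightarrow> dimension_filtration p (p * n) (multiple p g)"
| weaken: "dimension_filtration p (Suc n) g \<Longrightarrow> n \<ge> 1 \<Longrightarrow> dimension_filtration p n g"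

lemma dimension_filtration_pos:
  assumes "prime p" and "dimension_filtration p n g"
  shows "n \<ge> 1"
  using assms(2) prime_gt_0_nat[OF assms(1)] by induction auto

lemma dimension_filtration_antimono:
  assumes "dimension_filtration p n g" and "1 \<le> m" and "m \<le> n"
  shows "dimension_filtration p m g"
  using assms(3,1,2) by (induction rule: inc_induct) (auto intro: dimension_filtration.weaken)

text \<open>
  A group commutator minus \<open>1\<close> is the ring commutator up to a unit that is congruent to \<open>1\<close>. So the
  group commutator induces the Lie bracket on the associated graded ring.
\<close>

lemma group_commutator_minus_one:
  fixes g h :: "'g::group_add"
  defines "k \<equiv> (grp (- (h + g)) :: ('g, 'k::field) group_algebra)"
  shows "grp (g + h - g - h) - 1 = commutator (grp g - 1) (grp h - 1) * k"
proof -
  have "g + h - g - h = g + h + - (h + g)"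
    by (simp only: minus_add diff_conv_add_uminus add.assoc)
  moreover have "commutator (grp g - 1) (grp h - 1) = grp (g + h) - (grp (h + g) :: ('g, 'k) group_algebra)"
    by (simp add: commutator_def grp_add algebra_simps)
  ultimately show ?thesis
    by (simp only: k_def left_diff_distrib grp_uminus_right flip: grp_add)
      (simp only: grp_add[of "h + g" "- (h + g)"] grp_uminus_right)
qed

lemma commutator_aug_power:
  assumes "x \<in> aug_power i" and "y \<in> aug_power j"
  shows "commutator x y \<in> aug_power (i + j)"
  unfolding commutator_def
  using aug_power_mult[OF assms] aug_power_mult[OF assms(2,1)]
  by (intro additive_subgroup_diff aug_power_subgroup) (simp_all add: add.commute)

lemma commutator_diff_left: "commutator (x - y) z = commutator x z - commutator y z"
  and commutator_diff_right: "commutator z (x - y) = commutator z x - commutator z y"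
  and commutator_zero_left [simp]: "commutator 0 z = 0"
  and commutator_zero_right [simp]: "commutator z 0 = 0"
  by (simp_all add: commutator_def algebra_simps)

lemma commutator_scale:
  "commutator (c \<cdot> x) (d \<cdot> y) = (c * d) \<cdot> commutator x (y :: ('g::{finite, group_add}, 'k::field) group_algebra)"
  by (simp add: commutator_def scale_mult_left scale_mult_right
      group_algebra.scale_right_diff_distrib mult.commute)

lemma grp_minus_one_aug_power:
  assumes p: "prime p" and char: "of_nat p = (0::'k::field)"
    and "dimension_filtration p n (g :: 'g::{finite, group_add})"
  shows "(grp g :: ('g, 'k) group_algebra) - 1 \<in> aug_power n"
  using assms(3)
proof induction
  case (whole g)
  then show ?case by (simp only: aug_power_one grp_minus_one_mem)
next
  case (zero n)
  then show ?case using additive_subgroup_zero[OF aug_power_subgroup] by simp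
next
  case (add n g h)
  have "grp (g + h) - 1 = (grp g - 1) * grp h + ((grp h :: ('g, 'k) group_algebra) - 1)"
    by (simp add: grp_add algebra_simps)
  then show ?case
    using add.IH by (simp only: additive_subgroup_add[OF aug_power_subgroup] aug_power_right)
next
  case (uminus n g)
  have "grp (- g) - 1 = - ((grp g - 1) * (grp (- g) :: ('g, 'k) group_algebra))"
    by (simp add: left_diff_distrib)
  then show ?case
    using uminus.IH by (simp only: additive_subgroup_uminus[OF aug_power_subgroup] aug_power_right)
next
  case (commutator i g j h)
  then show ?case
    unfolding group_commutator_minus_one
    by (intro aug_power_right commutator_aug_power)
next
  case (multiple n g)
  have "grp (multiple p g) - 1 = (grp g - (1 :: ('g, 'k) group_algebra)) ^ p"
    by (simp add: grp_multiple power_minus_one_char_p[OF p of_nat_group_algebra[OF char]])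
  then show ?case using aug_power_power[OF multiple.IH, of p] by simp
next
  case (weaken n g)
  then show ?case using aug_power_antimono[of n "Suc n"] by (meson lessI less_imp_le subsetD)
qed

text \<open>
  The preimage in \<open>J\<^sup>n\<close> of the degree \<open>n\<close> part of the restricted Lie algebra \<open>L\<close>. Working with
  preimages avoids quotients: a congruence modulo \<open>J\<^bsup>n + 1\<^esup>\<close> becomes membership.
\<close>

definition dimension_space :: "nat \<Rightarrow> nat \<Rightarrow> ('g::{finite, group_add}, 'k::field) group_algebra set"
  where "dimension_space p n = additive_subgroup hull
    ({c \<cdot> (grp g - 1) | c g. dimension_filtration p n g} \<union> aug_power (Suc n))"

lemma dimension_space_subgroup: "additive_subgroup (dimension_space p n)"
  unfolding dimension_space_def by (rule additive_subgroup_hull)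

lemma dimension_space_grp: "dimension_filtration p n g \<Longrightarrow> c \<cdot> (grp g - 1) \<in> dimension_space p n"
  unfolding dimension_space_def by (rule hull_inc) blast

lemma dimension_space_higher: "aug_power (Suc n) \<subseteq> dimension_space p n"
  unfolding dimension_space_def by (auto intro: hull_inc)

lemma dimension_space_induct [consumes 1, case_names grp higher zero diff]:
  assumes "x \<in> dimension_space p n"
    and "\<And>c g. dimension_filtration p n g \<Longrightarrow> P (c \<cdot> (grp g - 1))"
    and "\<And>x. x \<in> aug_power (Suc n) \<Longrightarrow> P x"
    and "P 0" and "\<And>x y. x \<in> dimension_space p n \<Longrightarrow> y \<in> dimension_space p n \<Longrightarrow> P x \<Longrightarrow> P y \<Longrightarrow> P (x - y)"
  shows "P x"
proof -
  have "x \<in> dimension_space p n \<and> P x"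
    using assms(1)[unfolded dimension_space_def]
  proof (rule hull_induct)
    show "x \<in> dimension_space p n \<and> P x"
      if "x \<in> {c \<cdot> (grp g - 1) | c g. dimension_filtration p n g} \<union> aug_power (Suc n)" for x
      using that assms(2,3) dimension_space_grp dimension_space_higher by blast
    show "additive_subgroup {x. x \<in> dimension_space p n \<and> P x}"
      using assms(4,5) dimension_space_subgroup[of p n] by (auto simp: additive_subgroup_def)
  qed
  then show ?thesis ..
qed

context
  fixes p :: nat
  assumes p: "prime p" and char: "of_nat p = (0::'k::field)"
begin

lemma dimension_space_aug_power:
  "dimension_space p n \<subseteq> (aug_power n :: ('g::{finite, group_add}, 'k) group_algebra set)"
proof
  fix x :: "('g, 'k) group_algebra"
  assume "x \<in> dimension_space p n"
  then show "x \<in> aug_power n"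
  proof (induction rule: dimension_space_induct)
    case (grp c g)
    then show ?case by (intro aug_power_scale grp_minus_one_aug_power[OF p char])
  next
    case (higher x)
    then show ?case using aug_power_antimono[of n "Suc n"] by (meson lessI less_imp_le subsetD)
  qed (auto intro: additive_subgroup_zero additive_subgroup_diff aug_power_subgroup)
qed

lemma dimension_space_unit_mult:
  fixes x u :: "('g::{finite, group_add}, 'k) group_algebra"
  assumes "x \<in> dimension_space p n" and "u - 1 \<in> augmentation_ideal"
  shows "x * u \<in> dimension_space p n"
proof -
  have "x * (u - 1) \<in> aug_power (Suc n)"
    using assms dimension_space_aug_power by (blast intro: aug_power_mult_aug)
  then have "x + x * (u - 1) \<in> dimension_space p n"
    using dimension_space_higher assms(1) by (blast intro: additive_subgroup_add dimension_space_subgroup)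
  then show ?thesis by (simp add: right_diff_distrib)
qed

lemma dimension_space_commutator:
  fixes x y :: "('g::{finite, group_add}, 'k) group_algebra"
  assumes "x \<in> dimension_space p i" and "y \<in> dimension_space p j"
  shows "commutator x y \<in> dimension_space p (i + j)"
  using assms
proof (induction arbitrary: y rule: dimension_space_induct)
  case (grp c g)
  have g: "c \<cdot> (grp g - 1) \<in> aug_power i" for c :: 'k
    by (intro aug_power_scale grp_minus_one_aug_power[OF p char] grp.hyps)
  from grp.prems show ?case
  proof (induction rule: dimension_space_induct)
    case (grp d h)
    let ?k = "grp (h + g) :: ('g, 'k) group_algebra"
    have "(c * d) \<cdot> ((grp (g + h - g - h) - 1) * ?k) \<in> dimension_space p (i + j)"
      unfolding scale_mult_left[symmetric]
      by (intro dimension_space_unit_mult dimension_space_grp grp_minus_one_mem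
          dimension_filtration.commutator \<open>dimension_filtration p i g\<close> grp)
    also have "(grp (g + h - g - h) - 1) * ?k = commutator (grp g - 1) (grp h - 1)"
      unfolding group_commutator_minus_one mult.assoc grp_uminus_left by simp
    finally show ?case by (simp only: commutator_scale)
  next
    case (higher y)
    then have "commutator (c \<cdot> (grp g - 1)) y \<in> aug_power (i + Suc j)"
      by (rule commutator_aug_power[OF g])
    then show ?case using dimension_space_higher[of "i + j" p] by (auto)
  qed (auto simp: commutator_diff_right
      intro: additive_subgroup_zero additive_subgroup_diff dimension_space_subgroup)
next
  case (higher x)
  then have "commutator x y \<in> aug_power (Suc i + j)"
    using dimension_space_aug_power by (blast intro: commutator_aug_power)
  then show ?case using dimension_space_higher[of "i + j" p] by (auto)
qed (auto simp: commutator_diff_left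
    intro: additive_subgroup_zero additive_subgroup_diff dimension_space_subgroup)

lemma dimension_space_power:
  fixes x :: "('g::{finite, group_add}, 'k) group_algebra"
  assumes "x \<in> dimension_space p n"
  shows "x ^ p \<in> dimension_space p (p * n)"
  using assms
proof (induction rule: dimension_space_induct)
  case (grp c g)
  have "(c \<cdot> (grp g - 1)) ^ p = c ^ p \<cdot> (grp (multiple p g) - (1 :: ('g, 'k) group_algebra))"
    by (simp add: grp_multiple scale_power power_minus_one_char_p[OF p of_nat_group_algebra[OF char]])
  then show ?case
    using grp by (simp only: dimension_space_grp dimension_filtration.multiple)
next
  case (higher x)
  have "x ^ p \<in> aug_power (p * Suc n)" by (rule aug_power_power[OF higher])
  moreover have "Suc (p * n) \<le> p * Suc n" using prime_gt_0_nat[OF p] by simp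
  ultimately show ?case
    using aug_power_antimono dimension_space_higher by (blast dest: subsetD)
next
  case zero
  then show ?case
    using prime_gt_0_nat[OF p] by (simp add: additive_subgroup_zero dimension_space_subgroup zero_power)
next
  case (diff x y)
  note add = additive_subgroup_add[OF dimension_space_subgroup]
    and uminus = additive_subgroup_uminus[OF dimension_space_subgroup]
  \<comment> \<open>Commutators of length \<open>m\<close> in elements of degree \<open>n\<close> have degree \<open>m * n\<close>.\<close>
  have "(x + - y) ^ p - x ^ p - (- y) ^ p \<in> dimension_space p (p * n)"
  proof (rule jacobson_power_sum[where S = "\<lambda>m. dimension_space p (m * n)", OF p])
    show "of_nat p = (0 :: ('g, 'k) group_algebra)" by (rule of_nat_group_algebra[OF char])
    show "commutator x a \<in> dimension_space p (Suc m * n)"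
      if "a \<in> dimension_space p (m * n)" for m a
      using dimension_space_commutator[OF diff.hyps(1) that] by simp
    show "commutator (- y) a \<in> dimension_space p (Suc m * n)"
      if "a \<in> dimension_space p (m * n)" for m a
      using dimension_space_commutator[OF uminus[OF diff.hyps(2)] that] by simp
    show "0 \<in> dimension_space p (m * n)" for m
      by (rule additive_subgroup_zero[OF dimension_space_subgroup])
    show "x \<in> dimension_space p (1 * n)" using diff.hyps(1) by simp
  qed (rule add)
  then have "(x + - y) ^ p - x ^ p - (- y) ^ p + (x ^ p + - (y ^ p)) \<in> dimension_space p (p * n)"
    by (intro add uminus diff.IH)
  then show ?case by (simp add: uminus_power_char_p[OF p of_nat_group_algebra[OF char]])
qed

end

section \<open>Automorphisms preserve the Lie algebra\<close>

lemma algebra_automorphism_simps: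
  assumes "algebra_automorphism \<alpha>"
  shows "\<alpha> (x + y) = \<alpha> x + \<alpha> y" and "\<alpha> (c \<cdot> x) = c \<cdot> \<alpha> x" and "\<alpha> (x * y) = \<alpha> x * \<alpha> y" and "\<alpha> 1 = 1"
    and "\<alpha> 0 = 0" and "\<alpha> (- x) = - \<alpha> x" and "\<alpha> (x - y) = \<alpha> x - \<alpha> y" and "\<alpha> (x ^ n) = \<alpha> x ^ n"
proof -
  show add: "\<alpha> (x + y) = \<alpha> x + \<alpha> y" and "\<alpha> (c \<cdot> x) = c \<cdot> \<alpha> x" and mult: "\<alpha> (x * y) = \<alpha> x * \<alpha> y"
    and one: "\<alpha> 1 = 1" for x y c
    using assms by (auto simp: algebra_automorphism_def)
  show zero: "\<alpha> 0 = 0" using add[of 0 0] by simp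
  show uminus: "\<alpha> (- x) = - \<alpha> x" for x
    using add[of x "- x"] zero by (simp add: eq_neg_iff_add_eq_0 add.commute)
  show "\<alpha> (x - y) = \<alpha> x - \<alpha> y"
    using add[of x "- y"] uminus by simp
  show "\<alpha> (x ^ n) = \<alpha> x ^ n"
    by (induction n) (simp_all add: mult one)
qed

context
  fixes p m :: nat and \<alpha> :: "('g::{finite, group_add}, 'k::field) group_algebra \<Rightarrow> ('g, 'k) group_algebra"
  assumes p: "prime p" and char: "of_nat p = (0::'k)" and card: "CARD('g) = p ^ m"
    and \<alpha>: "algebra_automorphism \<alpha>"
begin

text \<open>
  \<open>J\<close> consists of the nilpotent elements of \<open>kG\<close>, and automorphisms preserve nilpotency.
\<close>

lemma automorphism_augmentation_ideal:
  assumes "x \<in> augmentation_ideal"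
  shows "\<alpha> x \<in> augmentation_ideal"
proof -
  obtain K where K: "ideal_power (augmentation_ideal :: ('g, 'k) group_algebra set) K = {0}"
    using augmentation_ideal_nilpotent[OF p card char] by blast
  have "x \<in> aug_power 1" by (simp only: assms aug_power_one)
  then have "x ^ K = 0"
    using aug_power_power[of x 1 K] K by simp
  then have "\<alpha> x ^ K = 0"
    by (metis algebra_automorphism_simps(5,8)[OF \<alpha>])
  then have "augmentation (\<alpha> x) ^ K = 0"
    by (metis augmentation_power augmentation_zero)
  then show ?thesis by (simp add: augmentation_ideal_def)
qed

lemma automorphism_grp: "\<alpha> (grp g) - 1 \<in> augmentation_ideal"
  using automorphism_augmentation_ideal[OF grp_minus_one_mem[of g]]
  by (simp add: algebra_automorphism_simps[OF \<alpha>])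

text \<open>
  Degree \<open>1\<close> is clear because \<open>L\<close> is all of \<open>J/J\<^sup>2\<close> there. The other rules of the filtration correspond to
  sums, brackets and \<open>p\<close>-th powers in \<open>L\<close>, which \<open>\<alpha>\<close> respects; and a group element that lies deeper in
  the filtration has image in a higher power of \<open>J\<close>.
\<close>

lemma automorphism_dimension_space:
  assumes "dimension_filtration p n g"
  shows "\<alpha> (grp g) - 1 \<in> dimension_space p n"
  using assms
proof induction
  case (whole g)
  let ?x = "\<alpha> (grp g) - 1"
  have "?x = (\<Sum>h\<in>UNIV. Poly_Mapping.lookup ?x h \<cdot> (grp h - 1))"
    by (rule augmentation_ideal_expansion[OF automorphism_grp])
  also have "\<dots> \<in> dimension_space p 1"
    by (intro additive_subgroup_sum dimension_space_subgroup dimension_space_grp dimension_filtration.whole)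
  finally show ?case .
next
  case (zero n)
  then show ?case
    by (simp add: algebra_automorphism_simps[OF \<alpha>] additive_subgroup_zero dimension_space_subgroup)
next
  case (add n g h)
  have "\<alpha> (grp (g + h)) - 1 = (\<alpha> (grp g) - 1) * \<alpha> (grp h) + (\<alpha> (grp h) - 1)"
    by (simp add: grp_add algebra_automorphism_simps[OF \<alpha>] algebra_simps)
  then show ?case
    using add.IH by (simp only: additive_subgroup_add[OF dimension_space_subgroup]
        dimension_space_unit_mult[OF p char] automorphism_grp)
next
  case (uminus n g)
  have "\<alpha> (grp g) * \<alpha> (grp (- g)) = 1"
    by (metis algebra_automorphism_simps(3,4)[OF \<alpha>] grp_uminus_right)
  then have eq: "\<alpha> (grp (- g)) - 1 = - ((\<alpha> (grp g) - 1) * \<alpha> (grp (- g)))"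
    by (simp add: left_diff_distrib)
  show ?case
    unfolding eq by (intro additive_subgroup_uminus[OF dimension_space_subgroup]
        dimension_space_unit_mult[OF p char] automorphism_grp uminus.IH)
next
  case (commutator i g j h)
  have "\<alpha> (grp (g + h - g - h)) - 1 = \<alpha> (grp (g + h - g - h) - 1)"
    by (simp add: algebra_automorphism_simps[OF \<alpha>])
  also have "\<dots> = commutator (\<alpha> (grp g) - 1) (\<alpha> (grp h) - 1) * \<alpha> (grp (- (h + g)))"
    unfolding group_commutator_minus_one
    by (simp add: commutator_def algebra_automorphism_simps[OF \<alpha>] del: minus_add)
  also have "\<dots> \<in> dimension_space p (i + j)"
    by (intro dimension_space_unit_mult[OF p char] automorphism_grp
        dimension_space_commutator[OF p char] commutator.IH)
  finally show ?case .
next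
  case (multiple n g)
  have "\<alpha> (grp (multiple p g)) - 1 = (\<alpha> (grp g) - 1) ^ p"
    by (simp add: grp_multiple algebra_automorphism_simps[OF \<alpha>]
        power_minus_one_char_p[OF p of_nat_group_algebra[OF char]])
  then show ?case
    using dimension_space_power[OF p char multiple.IH] by simp
next
  case (weaken n g)
  then show ?case
    using dimension_space_aug_power[OF p char] dimension_space_higher by (blast dest: subsetD)
qed

end

section \<open>Generators adapted to the dimension filtration\<close>

definition group_subset :: "'g::group_add set \<Rightarrow> bool"
  where "group_subset H \<longleftrightarrow> 0 \<in> H \<and> (\<forall>x\<in>H. \<forall>y\<in>H. x + y \<in> H) \<and> (\<forall>x\<in>H. - x \<in> H)"

lemma group_subset_multiple: "group_subset H \<Longrightarrow> g \<in> H \<Longrightarrow> multiple n g \<in> H"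
  by (induction n) (auto simp: group_subset_def)

text \<open>
  For \<open>g\<close> normalizing \<open>H\<close> with \<open>p\<close>-th power in \<open>H\<close>, this is the subgroup generated by \<open>g\<close> and \<open>H\<close>.
\<close>

definition cyclic_extension :: "'g::group_add \<Rightarrow> 'g set \<Rightarrow> 'g set"
  where "cyclic_extension g H = {multiple a g + h | a h. h \<in> H}"

context
  fixes p :: nat and g :: "'g::group_add" and H :: "'g set"
  assumes p: "prime p" and H: "group_subset H" and power: "multiple p g \<in> H"
    and normal: "\<And>h. h \<in> H \<Longrightarrow> - g + h + g \<in> H"
begin

lemma conjugate_multiple:
  assumes "h \<in> H"
  shows "- multiple a g + h + multiple a g \<in> H"
proof (induction a)
  case (Suc a)
  have "multiple (Suc a) g = multiple a g + g"
    using multiple_add[of a 1 g] by simp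
  then have "- multiple (Suc a) g + h + multiple (Suc a) g
      = - g + (- multiple a g + h + multiple a g) + g"
    by (simp only: minus_add add.assoc)
  then show ?case using normal[OF Suc] by simp
qed (simp add: assms)

lemma multiple_period: "multiple (p * q) g \<in> H"
  using group_subset_multiple[OF H power, of q] by (simp add: mult.commute flip: multiple_mult)

lemma cyclic_extension_subgroup: "group_subset (cyclic_extension g H)"
  unfolding group_subset_def
proof (intro conjI ballI)
  show "0 \<in> cyclic_extension g H"
    using H unfolding cyclic_extension_def group_subset_def
    by (intro CollectI exI[of _ 0]) auto
next
  fix x y assume "x \<in> cyclic_extension g H" "y \<in> cyclic_extension g H"
  then obtain a h b k where x: "x = multiple a g + h" "h \<in> H" and y: "y = multiple b g + k" "k \<in> H"
    by (auto simp: cyclic_extension_def)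
  have "x + y = multiple (a + b) g + ((- multiple b g + h + multiple b g) + k)"
    by (simp add: x y multiple_add add.assoc)
  moreover have "(- multiple b g + h + multiple b g) + k \<in> H"
    using H conjugate_multiple[OF x(2)] y(2) by (simp add: group_subset_def)
  ultimately show "x + y \<in> cyclic_extension g H"
    unfolding cyclic_extension_def by blast
next
  fix x assume "x \<in> cyclic_extension g H"
  then obtain a h where x: "x = multiple a g + h" "h \<in> H"
    by (auto simp: cyclic_extension_def)
  define c where "c = multiple ((p - 1) * a) g"
  have "a + (p - 1) * a = p * a"
    using prime_gt_0_nat[OF p] by (cases p) simp_all
  then have "multiple a g + c = multiple (p * a) g"
    by (simp add: c_def flip: multiple_add)
  then have "multiple a g + c \<in> H" by (simp add: multiple_period)
  moreover have "- c + h + c \<in> H"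
    unfolding c_def by (rule conjugate_multiple[OF x(2)])
  ultimately have "- ((multiple a g + c) + (- c + h + c)) \<in> H"
    using H unfolding group_subset_def by blast
  \<comment> \<open>Up to an element of \<open>H\<close>, the inverse of \<open>multiple a g\<close> is its power \<open>c\<close> with exponent \<open>p - 1\<close>.\<close>
  moreover have "- x = c + - ((multiple a g + c) + (- c + h + c))"
  proof -
    have "(multiple a g + c) + (- c + h + c) = x + c"
      by (simp add: x add.assoc)
    then show ?thesis by (simp only: minus_add add.assoc[symmetric] right_minus add_0_left)
  qed
  ultimately show "- x \<in> cyclic_extension g H"
    unfolding cyclic_extension_def c_def by blast
qed

lemma cyclic_extension_bij:
  assumes "g \<notin> H"
  shows "bij_betw (\<lambda>(a, h). multiple a g + h) ({..<p} \<times> H) (cyclic_extension g H)"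
proof (rule bij_betw_imageI)
  have no_collision: False if eq: "multiple a g + h = multiple b g + k"
    and ab: "a < b" "b < p" and hk: "h \<in> H" "k \<in> H" for a b h k
  proof -
    have "multiple b g = multiple a g + multiple (b - a) g"
      using ab by (simp flip: multiple_add)
    then have "multiple a g + h = multiple a g + (multiple (b - a) g + k)"
      using eq by (simp add: add.assoc)
    then have "h = multiple (b - a) g + k" by simp
    then have "multiple (b - a) g = h + - k" by (simp add: add.assoc)
    then have mem: "multiple (b - a) g \<in> H"
      using H hk by (simp add: group_subset_def del: add_uminus_conv_diff)
    have "0 < b - a" "b - a < p" using ab by auto
    then have "coprime (b - a) p"
      using p by (metis coprime_commute nat_dvd_not_less prime_imp_coprime)
    then obtain j where "[(b - a) * j = 1] (mod p)"
      using cong_solve_coprime_nat[of "b - a" p] by auto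
    then have "j * (b - a) mod p = 1"
      using prime_gt_1_nat[OF p] by (simp add: cong_def mult.commute)
    then obtain q where j: "j * (b - a) = p * q + 1"
      by (metis mult_div_mod_eq)
    have "multiple (j * (b - a)) g = multiple (p * q) g + multiple 1 g"
      by (simp only: j multiple_add)
    then have "g = - multiple (p * q) g + multiple j (multiple (b - a) g)"
      by (simp add: add.assoc flip: multiple_mult)
    also have "\<dots> \<in> H"
      using H group_subset_multiple[OF H mem, of j] multiple_period[of q]
      by (simp add: group_subset_def)
    finally show False using \<open>g \<notin> H\<close> by simp
  qed
  show "inj_on (\<lambda>(a, h). multiple a g + h) ({..<p} \<times> H)"
  proof (rule inj_onI)
    fix x y :: "nat \<times> 'g"
    assume xy: "x \<in> {..<p} \<times> H" "y \<in> {..<p} \<times> H"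
      and eq: "(case x of (a, h) \<Rightarrow> multiple a g + h) = (case y of (a, h) \<Rightarrow> multiple a g + h)"
    obtain a h b k where [simp]: "x = (a, h)" "y = (b, k)" by (cases x, cases y)
    have "a = b"
      using no_collision[of a h b k] no_collision[of b k a h] xy eq
      by (cases a b rule: linorder_cases) auto
    then show "x = y" using eq by simp
  qed
  show "(\<lambda>(a, h). multiple a g + h) ` ({..<p} \<times> H) = cyclic_extension g H"
  proof
    show "cyclic_extension g H \<subseteq> (\<lambda>(a, h). multiple a g + h) ` ({..<p} \<times> H)"
    proof
      fix x assume "x \<in> cyclic_extension g H"
      then obtain a h where x: "x = multiple a g + h" "h \<in> H"
        by (auto simp: cyclic_extension_def)
      have "x = multiple (a mod p) g + (multiple (p * (a div p)) g + h)"
        using x(1) by (simp flip: multiple_add add.assoc)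
      moreover have "multiple (p * (a div p)) g + h \<in> H"
        using H multiple_period x(2) by (simp add: group_subset_def)
      moreover have "a mod p < p" using prime_gt_0_nat[OF p] by simp
      ultimately show "x \<in> (\<lambda>(a, h). multiple a g + h) ` ({..<p} \<times> H)"
        by (intro image_eqI[of _ _ "(a mod p, multiple (p * (a div p)) g + h)"]) auto
    qed
  qed (auto simp: cyclic_extension_def)
qed

text \<open>
  The element sum of \<open>cyclic_extension g H\<close> is that of \<open>H\<close> times the geometric sum of the first \<open>p\<close> powers of \<open>g\<close>,
  and the latter equals \<open>(g - 1)\<^bsup>p - 1\<^esup>\<close> in characteristic \<open>p\<close>.
\<close>

lemma sum_cyclic_extension:
  assumes "g \<notin> H" and char: "of_nat p = (0::'k::field)"
  shows "(\<Sum>x\<in>cyclic_extension g H. grp x :: ('g, 'k) group_algebra)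
    = (grp g - 1) ^ (p - 1) * (\<Sum>h\<in>H. grp h)"
proof -
  have "(\<Sum>x\<in>cyclic_extension g H. grp x :: ('g, 'k) group_algebra)
      = (\<Sum>(a, h)\<in>{..<p} \<times> H. grp (multiple a g + h))"
    by (subst sum.reindex_bij_betw[OF cyclic_extension_bij[OF \<open>g \<notin> H\<close>], symmetric])
      (simp add: case_prod_unfold)
  also have "\<dots> = (\<Sum>a<p. grp g ^ a) * (\<Sum>h\<in>H. grp h)"
    by (simp add: grp_add grp_multiple sum_product sum.cartesian_product)
  finally show ?thesis
    by (simp only: geometric_sum_char_p[OF p of_nat_group_algebra[OF char]])
qed

end

text \<open>
  A pair \<open>(v, g)\<close> stands for the element \<open>g - 1\<close> of \<open>kG\<close>, considered in degree \<open>v\<close>.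
\<close>

definition letter_span :: "(nat \<times> 'g::{finite, group_add}) list \<Rightarrow> nat \<Rightarrow> ('g, 'k::field) group_algebra set"
  where "letter_span ls n =
    additive_subgroup hull ({c \<cdot> (grp g - 1) | c g. (n, g) \<in> set ls} \<union> aug_power (Suc n))"

lemma letter_span_subgroup: "additive_subgroup (letter_span ls n)"
  unfolding letter_span_def by (rule additive_subgroup_hull)

lemma letter_span_letter:
  assumes "(n, g) \<in> set ls"
  shows "grp g - 1 \<in> letter_span ls n"
proof -
  have "1 \<cdot> (grp g - 1) \<in> letter_span ls n"
    unfolding letter_span_def by (rule hull_inc) (use assms in blast)
  then show ?thesis by simp
qed

lemma letter_span_higher: "aug_power (Suc n) \<subseteq> letter_span ls n"
  unfolding letter_span_def by (auto intro: hull_inc)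

lemma letter_span_mono: "set ls \<subseteq> set ls' \<Longrightarrow> letter_span ls n \<subseteq> letter_span ls' n"
  unfolding letter_span_def by (rule hull_mono) auto

context
  fixes p :: nat and ty :: "'k::field itself"
  assumes p: "prime p" and char: "of_nat p = (0::'k)"
begin

lemma letter_span_grp_add:
  fixes x y :: "'g::{finite, group_add}"
  assumes "n \<ge> 1" and "dimension_filtration p n x" and "dimension_filtration p n y"
    and "grp x - 1 \<in> (letter_span ls n :: ('g, 'k) group_algebra set)" and "grp y - 1 \<in> (letter_span ls n :: ('g, 'k) group_algebra set)"
  shows "grp (x + y) - 1 \<in> (letter_span ls n :: ('g, 'k) group_algebra set)"
proof -
  \<comment> \<open>\<open>xy - 1 = (x - 1) + (y - 1) + (x - 1)(y - 1)\<close>, and the last product has degree above \<open>n\<close>.\<close>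
  have "(grp x - 1) * (grp y - 1 :: ('g, 'k) group_algebra) \<in> aug_power (n + n)"
    using assms(2,3) by (intro aug_power_mult grp_minus_one_aug_power[OF p char])
  moreover have "Suc n \<le> n + n" using assms(1) by simp
  ultimately have "(grp x - 1) * (grp y - 1 :: ('g, 'k) group_algebra) \<in> letter_span ls n"
    using aug_power_antimono letter_span_higher by (blast dest: subsetD)
  then have "(grp x - 1) * (grp y - 1) + ((grp x - 1) + (grp y - 1))
      \<in> (letter_span ls n :: ('g, 'k) group_algebra set)"
    using assms(4,5) by (intro additive_subgroup_add letter_span_subgroup)
  also have "(grp x - 1) * (grp y - 1) + ((grp x - 1) + (grp y - 1))
      = (grp (x + y) - 1 :: ('g, 'k) group_algebra)"
    by (simp add: grp_add algebra_simps)
  finally show ?thesis .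
qed

text \<open>
  The situation after the subgroup \<open>H\<close>, which lies between steps \<open>w + 1\<close> and \<open>w\<close> of the filtration, has been
  exhausted by cyclic extensions: the letters factor its element sum and span \<open>L\<close> above degree \<open>w\<close>, and
  in degree \<open>w\<close> they span the contribution of \<open>H\<close>.
\<close>

definition adapted_letters ::
  "nat \<Rightarrow> 'g::{finite, group_add} set \<Rightarrow> (nat \<times> 'g) list \<Rightarrow> bool"
  where "adapted_letters w H ls \<longleftrightarrow>
    (\<forall>(v, g)\<in>set ls. dimension_filtration p v g) \<and>
    (\<Sum>h\<in>H. grp h :: ('g, 'k) group_algebra) = prod_list (map (\<lambda>(v, g). (grp g - 1) ^ (p - 1)) ls) \<and>
    (\<forall>v>w. \<forall>h. dimension_filtration p v h \<longrightarrow> grp h - 1 \<in> (letter_span ls v :: ('g, 'k) group_algebra set)) \<and>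
    (\<forall>h\<in>H. grp h - 1 \<in> (letter_span ls w :: ('g, 'k) group_algebra set))"

lemma dimension_filtration_subgroup:
  "n \<ge> 1 \<Longrightarrow> group_subset {h. dimension_filtration p n h}"
  by (auto simp: group_subset_def intro: dimension_filtration.intros)

text \<open>
  Consecutive steps of the filtration have an elementary abelian quotient: commutators of elements of step
  \<open>w\<close> lie in step \<open>2 w\<close> and \<open>p\<close>-th powers in step \<open>p w\<close>, both beyond \<open>w\<close>. So any element of step \<open>w\<close>
  outside \<open>H\<close> normalizes \<open>H\<close> and has its \<open>p\<close>-th power there, and \<open>H\<close> can be enlarged until it fills the step.
\<close>

lemma adapted_letters_fill_layer:
  fixes H :: "'g::{finite, group_add} set"
  assumes w: "w \<ge> 1" and "group_subset H"
    and "{h. dimension_filtration p (Suc w) h} \<subseteq> H" and "H \<subseteq> {h. dimension_filtration p w h}"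
    and "adapted_letters w H ls"
  shows "\<exists>ls'. adapted_letters w {h :: 'g. dimension_filtration p w h} ls'"
  using assms(2-)
proof (induction "card {h :: 'g. dimension_filtration p w h} - card H" arbitrary: H ls rule: less_induct)
  case (less H ls)
  let ?D = "{h :: 'g. dimension_filtration p w h}"
  show ?case
  proof (cases "H = ?D")
    case True
    then show ?thesis using less.prems by blast
  next
    case False
    then obtain g where g: "dimension_filtration p w g" "g \<notin> H"
      using less.prems(3) by blast
    let ?H = "cyclic_extension g H"
    have upper: "x \<in> H" if "dimension_filtration p n x" "Suc w \<le> n" for n x
      using dimension_filtration_antimono[OF that(1) _ that(2)] less.prems(2) by auto
    have power: "multiple p g \<in> H"
    proof (rule upper[OF dimension_filtration.multiple[OF g(1)]])
      have "2 * w \<le> p * w" using prime_ge_2_nat[OF p] by simp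
      then show "Suc w \<le> p * w" using w by linarith
    qed
    have normal: "- g + h + g \<in> H" if "h \<in> H" for h
    proof -
      have "dimension_filtration p w h" using that less.prems(3) by blast
      then have "- g + h - - g - h \<in> H"
        using w by (intro upper[OF dimension_filtration.commutator[OF dimension_filtration.uminus[OF g(1)]]]) auto
      then have "(- g + h - - g - h) + h \<in> H"
        using that less.prems(1) unfolding group_subset_def by blast
      then show ?thesis by (simp only: diff_add_cancel diff_minus_eq_add)
    qed
    note extension = p less.prems(1) power normal
    have multiple_mem: "dimension_filtration p w (multiple a g)" for a
      using group_subset_multiple[OF dimension_filtration_subgroup[OF w], of g a] g(1) by simp
    have sub: "H \<subseteq> ?H"
    proof
      fix h assume "h \<in> H"
      then show "h \<in> ?H"
        unfolding cyclic_extension_def by (intro CollectI exI[of _ 0] exI[of _ h]) simp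
    qed
    have "g \<in> ?H"
      using less.prems(1) unfolding cyclic_extension_def group_subset_def
      by (intro CollectI exI[of _ 1] exI[of _ 0]) simp
    have sub': "?H \<subseteq> ?D"
      using less.prems(3) multiple_mem by (auto simp: cyclic_extension_def intro: dimension_filtration.add)
    have "card H < card ?H"
      using sub \<open>g \<in> ?H\<close> g(2) by (intro psubset_card_mono) auto
    moreover have "card ?H \<le> card ?D"
      using sub' by (intro card_mono) auto
    ultimately have smaller: "card ?D - card ?H < card ?D - card H" by linarith
    have mono: "x \<in> letter_span ((w, g) # ls) v" if "x \<in> letter_span ls v" for x :: "('g, 'k) group_algebra" and v
      using letter_span_mono[of ls "(w, g) # ls" v] that by auto
    have "grp (multiple a g) - 1 \<in> (letter_span ((w, g) # ls) w :: ('g, 'k) group_algebra set)" for a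
    proof (induction a)
      case 0
      show ?case by (simp add: additive_subgroup_zero letter_span_subgroup)
    next
      case (Suc a)
      show ?case
        unfolding multiple_Suc
        by (rule letter_span_grp_add[OF w g(1) multiple_mem letter_span_letter Suc]) simp
    qed
    then have layer: "grp x - 1 \<in> (letter_span ((w, g) # ls) w :: ('g, 'k) group_algebra set)" if "x \<in> ?H" for x
      using that less.prems(3,4) multiple_mem mono w unfolding cyclic_extension_def adapted_letters_def
      by (blast intro: letter_span_grp_add)
    have "adapted_letters w ?H ((w, g) # ls)"
      using less.prems(4) mono layer g(1) sum_cyclic_extension[OF extension g(2) char]
      unfolding adapted_letters_def by simp
    then show ?thesis
      using less.hyps[OF smaller] sub sub' less.prems(2) cyclic_extension_subgroup[OF extension]
      by blast
  qed
qed

text \<open>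
  The filtration is filled from the bottom. It starts at the trivial group because \<open>J\<close> is nilpotent: an
  element \<open>h\<close> of step \<open>K\<close> has \<open>h - 1 \<in> J\<^sup>K = 0\<close>.
\<close>

theorem adapted_letters_exist:
  assumes "CARD('g::{finite, group_add}) = p ^ m"
  obtains ls where "\<And>v g. (v, g) \<in> set ls \<Longrightarrow> dimension_filtration p v g"
    and "(\<Sum>h\<in>UNIV. grp h :: ('g, 'k) group_algebra) = prod_list (map (\<lambda>(v, g). (grp g - 1) ^ (p - 1)) ls)"
    and "\<And>v h. dimension_filtration p v h \<Longrightarrow> grp h - 1 \<in> (letter_span ls v :: ('g, 'k) group_algebra set)"
proof -
  obtain K where K: "(aug_power K :: ('g, 'k) group_algebra set) = {0}"
    using augmentation_ideal_nilpotent[OF p assms char] by blast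
  have trivial: "h = 0" if "dimension_filtration p v h" "K \<le> v" for v and h :: 'g
  proof -
    have "grp h - 1 \<in> (aug_power K :: ('g, 'k) group_algebra set)"
      using grp_minus_one_aug_power[OF p char that(1)] aug_power_antimono[OF that(2)] by blast
    then have "grp h = (grp 0 :: ('g, 'k) group_algebra)" using K by simp
    then show ?thesis by (metis lookup_single_eq lookup_single_not_eq zero_neq_one)
  qed
  have "\<exists>ls. adapted_letters w {h :: 'g. dimension_filtration p w h} ls" if "1 \<le> w" "w \<le> Suc K" for w
    using that(2,1)
  proof (induction rule: inc_induct)
    case base
    have "{h :: 'g. dimension_filtration p (Suc K) h} = {0}"
      using trivial[of "Suc K"] by (auto intro: dimension_filtration.zero)
    moreover have "grp h - 1 \<in> (letter_span [] v :: ('g, 'k) group_algebra set)"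
      if "dimension_filtration p v h" "Suc K < v" for v and h :: 'g
      using trivial[OF that(1)] that(2) additive_subgroup_zero[OF letter_span_subgroup, of "[]" v]
      by simp
    ultimately have "adapted_letters (Suc K) {h :: 'g. dimension_filtration p (Suc K) h} []"
      by (simp add: adapted_letters_def additive_subgroup_zero letter_span_subgroup)
    then show ?case by blast
  next
    case (step w)
    then obtain ls where ls: "adapted_letters (Suc w) {h :: 'g. dimension_filtration p (Suc w) h} ls"
      by auto
    show ?case
    proof (rule adapted_letters_fill_layer)
      show "1 \<le> w" by fact
      show "group_subset {h :: 'g. dimension_filtration p (Suc w) h}"
        by (rule dimension_filtration_subgroup) simp
      show "{h :: 'g. dimension_filtration p (Suc w) h} \<subseteq> {h. dimension_filtration p w h}"
        using \<open>1 \<le> w\<close> by (auto intro: dimension_filtration.weaken)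
      have "grp h - 1 \<in> (letter_span ls w :: ('g, 'k) group_algebra set)"
        if "dimension_filtration p (Suc w) h" for h :: 'g
        using grp_minus_one_aug_power[OF p char that] letter_span_higher by blast
      moreover have "grp h - 1 \<in> (letter_span ls v :: ('g, 'k) group_algebra set)"
        if "dimension_filtration p v h" "w < v" for v and h :: 'g
        using that ls by (cases "v = Suc w") (auto simp: adapted_letters_def)
      ultimately show "adapted_letters w {h :: 'g. dimension_filtration p (Suc w) h} ls"
        using ls by (simp add: adapted_letters_def)
    qed simp
  qed
  then obtain ls where ls: "adapted_letters 1 {h :: 'g. dimension_filtration p 1 h} ls"
    by auto
  show ?thesis
  proof
    show "dimension_filtration p v g" if "(v, g) \<in> set ls" for v g
      using ls that by (auto simp: adapted_letters_def)
    have whole: "{h :: 'g. dimension_filtration p 1 h} = UNIV"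
      using dimension_filtration.whole by blast
    show "(\<Sum>h\<in>UNIV. grp h :: ('g, 'k) group_algebra) = prod_list (map (\<lambda>(v, g). (grp g - 1) ^ (p - 1)) ls)"
      using ls by (simp only: adapted_letters_def whole)
    show "grp h - 1 \<in> (letter_span ls v :: ('g, 'k) group_algebra set)"
      if "dimension_filtration p v h" for v h
      using ls that dimension_filtration_pos[OF p that]
      by (cases "v = 1") (auto simp: adapted_letters_def whole)
  qed
qed

end

section \<open>Words in the adapted generators\<close>

text \<open>
  Adjacent transpositions connect any two lists with the same multiset of entries. The hypothesis on
  swaps is restricted to rearrangements of the given multiset, which keeps degree and length of words
  under control.
\<close>

lemma permutation_invariant:
  assumes refl: "\<And>u. R u u" and trans: "\<And>u v w. R u v \<Longrightarrow> R v w \<Longrightarrow> R u w"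
    and swap: "\<And>pre i j post. mset (pre @ [i, j] @ post) = M \<Longrightarrow> R (pre @ [i, j] @ post) (pre @ [j, i] @ post)"
    and "mset u = M" and "mset v = M"
  shows "R u v"
proof -
  have bubble: "R (pre @ [a] @ us @ vs) (pre @ us @ [a] @ vs)"
    if "mset (pre @ [a] @ us @ vs) = M" for pre us a vs
    using that
  proof (induction us arbitrary: pre)
    case Nil
    show ?case by (simp add: refl)
  next
    case (Cons b us)
    have "R (pre @ [a, b] @ (us @ vs)) (pre @ [b, a] @ (us @ vs))"
      by (rule swap) (use Cons.prems in simp)
    moreover have "R ((pre @ [b]) @ [a] @ us @ vs) ((pre @ [b]) @ us @ [a] @ vs)"
      by (rule Cons.IH) (use Cons.prems in \<open>simp add: add_mset_commute\<close>)
    ultimately show ?case using trans by fastforce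
  qed
  have "R (pre @ u) (pre @ v)" if "mset (pre @ u) = M" "mset u = mset v" for pre u v
    using that
  proof (induction u arbitrary: pre v)
    case Nil
    then show ?case by (simp add: refl)
  next
    case (Cons a u)
    then have "a \<in> set v" by (metis list.set_intros(1) mset_eq_setD)
    then obtain us vs where v: "v = us @ [a] @ vs" by (auto dest: split_list)
    have 1: "R ((pre @ [a]) @ u) ((pre @ [a]) @ (us @ vs))"
      by (rule Cons.IH) (use Cons.prems v in auto)
    have 2: "R (pre @ [a] @ us @ vs) (pre @ us @ [a] @ vs)"
      by (rule bubble) (use Cons.prems v in simp)
    show ?case using trans[OF 1] 2 v by simp
  qed
  then show ?thesis using assms(4,5) by (metis append_Nil)
qed

lemma letter_span_induct [consumes 1, case_names letter higher zero diff]: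
  assumes "x \<in> letter_span ls n"
    and "\<And>c g. (n, g) \<in> set ls \<Longrightarrow> P (c \<cdot> (grp g - 1))"
    and "\<And>x. x \<in> aug_power (Suc n) \<Longrightarrow> P x"
    and "P 0" and "\<And>x y. P x \<Longrightarrow> P y \<Longrightarrow> P (x - y)"
  shows "P x"
  using assms(1)[unfolded letter_span_def]
  by (rule hull_induct) (use assms(2-) in \<open>auto simp: additive_subgroup_def\<close>)

lemma letter_span_scale:
  assumes "x \<in> letter_span ls n"
  shows "c \<cdot> x \<in> letter_span ls n"
  using assms
proof (induction rule: letter_span_induct)
  case (letter d g)
  then show ?case
    unfolding group_algebra.scale_scale letter_span_def by (intro hull_inc) blast
next
  case (higher x)
  then show ?case using aug_power_scale letter_span_higher by blast
qed (simp_all add: group_algebra.scale_right_diff_distrib additive_subgroup_zero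
    additive_subgroup_diff letter_span_subgroup)

text \<open>
  The generators of \<open>adapted_letters_exist\<close>, indexed by \<open>{..<r}\<close> so that equal letters at different
  positions of the list count as different. The parameter \<open>ty\<close> fixes the coefficient field.
\<close>

locale adapted_generators =
  fixes p r :: nat and wt :: "nat \<Rightarrow> nat" and gen :: "nat \<Rightarrow> 'g::{finite, group_add}"
    and ty :: "'k::field itself"
  assumes p: "prime p" and char: "of_nat p = (0::'k)"
    and p_group: "\<exists>m. CARD('g) = p ^ m"
    and gen: "\<And>i. i < r \<Longrightarrow> dimension_filtration p (wt i) (gen i)"
    and spanning: "\<And>v h. dimension_filtration p v h \<Longrightarrow>
      grp h - 1 \<in> (letter_span (map (\<lambda>i. (wt i, gen i)) [0..<r]) v :: ('g, 'k) group_algebra set)"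
begin

abbreviation span_of_weight :: "nat \<Rightarrow> ('g, 'k) group_algebra set"
  where "span_of_weight \<equiv> letter_span (map (\<lambda>i. (wt i, gen i)) [0..<r])"

definition letter :: "nat \<Rightarrow> ('g, 'k) group_algebra"
  where "letter i = grp (gen i) - 1"

definition word_value :: "nat list \<Rightarrow> ('g, 'k) group_algebra"
  where "word_value u = prod_list (map letter u)"

definition weight :: "nat list \<Rightarrow> nat"
  where "weight u = sum_list (map wt u)"

definition full_word :: "nat list"
  where "full_word = concat (map (replicate (p - 1)) [0..<r])"

lemma word_value_simps [simp]:
  "word_value [] = 1" "word_value (i # u) = letter i * word_value u"
  "word_value (u @ v) = word_value u * word_value v"
  by (simp_all add: word_value_def)

lemma weight_simps [simp]:
  "weight [] = 0" "weight (i # u) = wt i + weight u" "weight (u @ v) = weight u + weight v"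
  by (simp_all add: weight_def)

lemma weight_mset: "mset u = mset v \<Longrightarrow> weight u = weight v"
  unfolding weight_def by (metis mset_map sum_mset_sum_list)

lemma wt_pos: "i < r \<Longrightarrow> wt i \<ge> 1"
  using dimension_filtration_pos[OF p gen] .

lemma letter_dimension_space: "i < r \<Longrightarrow> letter i \<in> dimension_space p (wt i)"
  using dimension_space_grp[OF gen, of i 1] by (simp add: letter_def)

lemma letter_aug_power: "i < r \<Longrightarrow> letter i \<in> aug_power (wt i)"
  using letter_dimension_space dimension_space_aug_power[OF p char] by blast

lemma word_value_aug_power: "set u \<subseteq> {..<r} \<Longrightarrow> word_value u \<in> aug_power (weight u)"
proof (induction u)
  case (Cons i u)
  then have "letter i \<in> aug_power (wt i)" "word_value u \<in> aug_power (weight u)"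
    by (auto intro: letter_aug_power)
  then show ?case by (simp add: aug_power_mult)
qed simp

lemma dimension_space_span_of_weight: "dimension_space p n \<subseteq> span_of_weight n"
proof
  fix x :: "('g, 'k) group_algebra"
  assume "x \<in> dimension_space p n"
  then show "x \<in> span_of_weight n"
  proof (induction rule: dimension_space_induct)
    case (grp c g)
    then show ?case by (intro letter_span_scale spanning)
  next
    case (higher x)
    then show ?case using letter_span_higher by blast
  qed (auto intro: additive_subgroup_zero additive_subgroup_diff letter_span_subgroup)
qed

lemma span_of_weight_induct [consumes 1, case_names letter higher zero diff]:
  assumes "x \<in> span_of_weight n"
    and "\<And>c i. i < r \<Longrightarrow> wt i = n \<Longrightarrow> P (c \<cdot> letter i)"
    and "\<And>x. x \<in> aug_power (Suc n) \<Longrightarrow> P x"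
    and "P 0" and "\<And>x y. P x \<Longrightarrow> P y \<Longrightarrow> P (x - y)"
  shows "P x"
  using assms(1)
proof (induction rule: letter_span_induct)
  case (letter c g)
  then obtain i where "i < r" "wt i = n" "gen i = g" by auto
  then show ?case using assms(2)[of i c] by (simp add: letter_def)
qed (use assms in auto)

lemma mset_full_word: "mset full_word = (\<Sum>i<r. replicate_mset (p - 1) i)"
  unfolding full_word_def
proof (induction r)
  case (Suc r)
  then show ?case by (simp add: add.commute)
qed simp

lemma set_full_word: "set full_word \<subseteq> {..<r}"
  by (auto simp: full_word_def)

lemma count_full_word: "count (mset full_word) i = (if i < r then p - 1 else 0)"
  by (simp add: mset_full_word count_sum)

lemma weight_by_count:
  assumes "set u \<subseteq> {..<r}"
  shows "weight u = (\<Sum>i<r. count (mset u) i * wt i)"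
  using assms
proof (induction u)
  case (Cons j u)
  then have "(\<Sum>i<r. count (mset (j # u)) i * wt i)
      = (\<Sum>i<r. (if i = j then wt i else 0) + count (mset u) i * wt i)"
    by (intro sum.cong) auto
  also have "\<dots> = wt j + weight u"
    using Cons by (simp add: sum.distrib)
  finally show ?case by simp
qed simp

text \<open>
  If every exponent is at most \<open>p - 1\<close>, the weight is at most that of the full word, with equality only
  for rearrangements of the full word, as all letters have positive weight.
\<close>

lemma letter_repeated:
  assumes u: "set u \<subseteq> {..<r}" and "weight u \<ge> weight full_word" and "mset u \<noteq> mset full_word"
  obtains i where "i < r" and "count (mset u) i \<ge> p"
proof (rule ccontr)
  assume "\<not> thesis"
  then have "count (mset u) i < p" if "i < r" for i
    using that \<open>\<And>i. i < r \<Longrightarrow> p \<le> count (mset u) i \<Longrightarrow> thesis\<close> not_le by blast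
  then have small: "count (mset u) i \<le> count (mset full_word) i" if "i < r" for i
    using that by (fastforce simp: count_full_word)
  have outside: "count (mset u) i = count (mset full_word) i" if "\<not> i < r" for i
    using that u by (auto simp: count_full_word not_in_iff[symmetric])
  obtain j where "count (mset u) j \<noteq> count (mset full_word) j"
    using assms(3) multiset_eq_iff by blast
  then have j: "j < r" "count (mset u) j < count (mset full_word) j"
    using small outside by (blast, metis le_neq_implies_less outside small)
  have "weight u < weight full_word"
    unfolding weight_by_count[OF u] weight_by_count[OF set_full_word]
  proof (rule sum_strict_mono_ex1)
    show "\<exists>i\<in>{..<r}. count (mset u) i * wt i < count (mset full_word) i * wt i"
      using j wt_pos[OF j(1)] by (intro bexI[of _ j]) simp_all
  qed (use small in auto)
  then show False using assms(2) by simp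
qed

text \<open>
  Induction on the length of the word. Swapping neighbouring letters changes the value by a word in which the two
  letters are replaced by their commutator, an element of \<open>L\<close>; modulo higher degree this is a combination
  of words of the same weight with one letter less. The same happens with fewer letters still when \<open>p\<close> equal letters
  are collected to a \<open>p\<close>-th power. A word shorter than the full word is never a rearrangement of it, so by
  induction all these corrections vanish modulo \<open>J\<^bsup>d + 1\<^esup>\<close>. Hence the value depends only on
  the multiset of letters, and it vanishes if a letter occurs \<open>p\<close> times, which by \<open>letter_repeated\<close> is the case for every word
  that is not a rearrangement of the full word.
\<close>

theorem word_value_top:
  assumes "set u \<subseteq> {..<r}" and "weight u = d"
    and "d > weight full_word \<or> d = weight full_word \<and> length u \<le> length full_word"
  shows "word_value u - (if mset u = mset full_word then word_value full_word else 0) \<in> aug_power (Suc d)"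
  using assms
proof (induction "length u" arbitrary: u rule: less_induct)
  case (less u)
  have shorter: "word_value v \<in> aug_power (Suc d)"
    if "set v \<subseteq> {..<r}" "weight v = d" "length v < length u" for v
  proof -
    have "mset v \<noteq> mset full_word"
      using that(2,3) less.prems(3) weight_mset[of v full_word] mset_eq_length[of v full_word] by auto
    then show ?thesis
      using less.hyps[OF that(3,1,2)] that(3) less.prems(3) by auto
  qed
  have merge: "word_value pre * z * word_value post \<in> aug_power (Suc d)"
    if "z \<in> span_of_weight n" and "set (pre @ post) \<subseteq> {..<r}"
      and "weight pre + n + weight post = d" and "length pre + 1 + length post < length u"
    for pre post n z
    using that(1)
  proof (induction rule: span_of_weight_induct)
    case (letter c i)
    have "word_value (pre @ [i] @ post) \<in> aug_power (Suc d)"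
      by (rule shorter) (use letter that in auto)
    then have "c \<cdot> word_value (pre @ [i] @ post) \<in> aug_power (Suc d)"
      by (rule aug_power_scale)
    then show ?case by (simp add: scale_mult_left scale_mult_right mult.assoc)
  next
    case (higher z)
    have "word_value pre * z * word_value post \<in> aug_power (weight pre + Suc n + weight post)"
      using that(2) by (intro aug_power_mult word_value_aug_power higher) auto
    then show ?case using that(3) by simp
  next
    case zero
    then show ?case by (simp add: additive_subgroup_zero aug_power_subgroup)
  next
    case (diff x y)
    then show ?case
      by (simp add: right_diff_distrib left_diff_distrib
          additive_subgroup_diff aug_power_subgroup)
  qed
  have rearrange: "word_value u - word_value v \<in> aug_power (Suc d)" if v: "mset v = mset u" for v
  proof (rule permutation_invariant[where R = "\<lambda>u v. word_value u - word_value v \<in> aug_power (Suc d)", OF _ _ _ refl v])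
    show "word_value u - word_value u \<in> aug_power (Suc d)" for u
      by (simp add: additive_subgroup_zero aug_power_subgroup)
    show "word_value u - word_value w \<in> aug_power (Suc d)"
      if "word_value u - word_value v \<in> aug_power (Suc d)" "word_value v - word_value w \<in> aug_power (Suc d)" for u v w
      using additive_subgroup_add[OF aug_power_subgroup that] by simp
    fix pre post :: "nat list" and i j
    assume eq: "mset (pre @ [i, j] @ post) = mset u"
    have range: "set (pre @ [i, j] @ post) \<subseteq> {..<r}"
      using mset_eq_setD[OF eq] less.prems(1) by simp
    have "commutator (letter i) (letter j) \<in> dimension_space p (wt i + wt j)"
      using range by (intro dimension_space_commutator[OF p char] letter_dimension_space) auto
    then have "commutator (letter i) (letter j) \<in> span_of_weight (wt i + wt j)"
      using dimension_space_span_of_weight by blast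
    then have "word_value pre * commutator (letter i) (letter j) * word_value post \<in> aug_power (Suc d)"
    proof (rule merge)
      show "set (pre @ post) \<subseteq> {..<r}" using range by auto
      show "weight pre + (wt i + wt j) + weight post = d"
        using weight_mset[OF eq] less.prems(2) by simp
      show "length pre + 1 + length post < length u"
        using mset_eq_length[OF eq] by simp
    qed
    then show "word_value (pre @ [i, j] @ post) - word_value (pre @ [j, i] @ post) \<in> aug_power (Suc d)"
      by (simp add: commutator_def algebra_simps)
  qed
  show ?case
  proof (cases "mset u = mset full_word")
    case True
    then show ?thesis using rearrange[of full_word] by simp
  next
    case False
    have "weight u \<ge> weight full_word" using less.prems(2,3) by auto
    then obtain i where i: "i < r" "count (mset u) i \<ge> p"
      using letter_repeated[OF less.prems(1) _ False] by blast
    then have "replicate_mset p i \<subseteq># mset u" by (simp add: count_le_replicate_mset_subset_eq)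
    then obtain v where v: "mset u = mset (replicate p i @ v)"
      by (metis ex_mset mset_append mset_replicate subset_mset.le_iff_add)
    have "letter i ^ p \<in> span_of_weight (p * wt i)"
      using dimension_space_power[OF p char letter_dimension_space[OF i(1)]] dimension_space_span_of_weight
      by blast
    then have "word_value [] * letter i ^ p * word_value v \<in> aug_power (Suc d)"
    proof (rule merge)
      show "set ([] @ v) \<subseteq> {..<r}"
        using mset_eq_setD[OF v] less.prems(1) by auto
      have "weight (replicate p i) = p * wt i" by (simp add: weight_def sum_list_replicate)
      then show "weight [] + p * wt i + weight v = d"
        using weight_mset[OF v] less.prems(2) by simp
      show "length [] + 1 + length v < length u"
        using mset_eq_length[OF v] prime_gt_1_nat[OF p] by simp
    qed
    moreover have "word_value (replicate p i) = letter i ^ p"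
      by (simp add: word_value_def)
    ultimately have "word_value (replicate p i @ v) \<in> aug_power (Suc d)" by simp
    then have "word_value u - word_value (replicate p i @ v) + word_value (replicate p i @ v) \<in> aug_power (Suc d)"
      by (rule additive_subgroup_add[OF aug_power_subgroup rearrange[OF v[symmetric]]])
    then show ?thesis
      using False by simp
  qed
qed

text \<open>
  \<open>J\<close> is spanned by the letters of weight \<open>1\<close> modulo \<open>J\<^sup>2\<close>, and \<open>J\<^sup>d\<close> by \<open>d\<close>-fold products from \<open>J\<close>.
\<close>

lemma aug_power_words:
  "aug_power d \<subseteq> additive_subgroup hull
    ({c \<cdot> word_value u | c u. set u \<subseteq> {..<r} \<and> weight u = d} \<union> aug_power (Suc d))"
    (is "_ \<subseteq> ?W d")
proof -
  have W: "additive_subgroup (?W d)" for d by (rule additive_subgroup_hull)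
  have word: "c \<cdot> word_value u \<in> ?W d" if "set u \<subseteq> {..<r}" "weight u = d" for c u d
    using that by (intro hull_inc) blast
  have higher: "x \<in> ?W d" if "x \<in> aug_power (Suc d)" for x d
    using that by (intro hull_inc UnI2)
  have first: "x \<in> span_of_weight 1" if "x \<in> augmentation_ideal" for x
  proof -
    have "x = (\<Sum>g\<in>UNIV. Poly_Mapping.lookup x g \<cdot> (grp g - 1))"
      by (rule augmentation_ideal_expansion[OF that])
    also have "\<dots> \<in> span_of_weight 1"
      by (intro additive_subgroup_sum letter_span_subgroup letter_span_scale spanning dimension_filtration.whole)
    finally show ?thesis .
  qed
  show ?thesis
  proof (induction d)
    case 0
    show ?case
    proof
      fix x :: "('g, 'k) group_algebra"
      have "x - augmentation x \<cdot> 1 \<in> aug_power 1"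
        by (simp only: aug_power_one) (simp add: augmentation_ideal_def augmentation_diff augmentation_scale)
      then have "x - augmentation x \<cdot> 1 \<in> ?W 0" by (intro higher) simp
      moreover have "augmentation x \<cdot> 1 \<in> ?W 0" using word[of "[]" 0] by simp
      ultimately have "x - augmentation x \<cdot> 1 + augmentation x \<cdot> 1 \<in> ?W 0"
        by (rule additive_subgroup_add[OF W])
      then show "x \<in> ?W 0" by simp
    qed
  next
    case (Suc d)
    have mult_letter: "x * y \<in> ?W (Suc d)" if "x = c \<cdot> word_value u" "set u \<subseteq> {..<r}" "weight u = d"
      and "y \<in> span_of_weight 1" for x y c u
      using that(4)
    proof (induction rule: span_of_weight_induct)
      case (letter e i)
      have "(c * e) \<cdot> word_value (u @ [i]) \<in> ?W (Suc d)"
        by (rule word) (use letter that in auto)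
      then show ?case by (simp add: that(1) scale_mult_left scale_mult_right mult.commute)
    next
      case (higher y)
      have "x \<in> aug_power d"
        using word_value_aug_power[OF that(2)] by (simp add: that(1,3) aug_power_scale)
      then have "x * y \<in> aug_power (Suc (Suc d))"
        using aug_power_mult[OF _ higher, of x d] by simp
      then show ?case by (intro hull_inc UnI2)
    qed (use W in \<open>simp_all add: additive_subgroup_zero additive_subgroup_diff right_diff_distrib\<close>)
    show ?case
    proof
      fix x :: "('g, 'k) group_algebra"
      assume "x \<in> aug_power (Suc d)"
      then show "x \<in> ?W (Suc d)"
      proof (induction rule: ideal_power_Suc_induct)
        case (mult x y)
        from mult(1) Suc have "x \<in> ?W d" by blast
        then show ?case
        proof (rule hull_induct)
          show "x * y \<in> ?W (Suc d)"
            if "x \<in> {c \<cdot> word_value u | c u. set u \<subseteq> {..<r} \<and> weight u = d} \<union> aug_power (Suc d)" for x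
            using that
          proof
            assume "x \<in> aug_power (Suc d)"
            then show ?thesis by (intro higher aug_power_mult_aug mult(2))
          qed (use mult_letter first[OF mult(2)] in blast)
          show "additive_subgroup {x. x * y \<in> ?W (Suc d)}"
            using W[of "Suc d"] by (auto simp: additive_subgroup_def left_diff_distrib)
        qed
      qed (use W[of "Suc d"] in \<open>simp_all add: additive_subgroup_zero additive_subgroup_diff\<close>)
    qed
  qed
qed

text \<open>
  In degrees above the weight of the full word, words lie in the next power of \<open>J\<close>. So the powers of \<open>J\<close> are
  constant from there on, and since \<open>J\<close> is nilpotent they are \<open>0\<close>.
\<close>

theorem aug_power_top: "aug_power (Suc (weight full_word)) = ({0} :: ('g, 'k) group_algebra set)"
proof -
  obtain K where K: "(aug_power K :: ('g, 'k) group_algebra set) = {0}"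
    using p_group augmentation_ideal_nilpotent[OF p _ char, where 'g = 'g] by blast
  have step: "aug_power d \<subseteq> (aug_power (Suc d) :: ('g, 'k) group_algebra set)" if "d > weight full_word" for d
  proof -
    have "word_value u \<in> aug_power (Suc d)" if "set u \<subseteq> {..<r}" "weight u = d" for u
    proof -
      have "mset u \<noteq> mset full_word" using weight_mset[of u full_word] that(2) \<open>d > _\<close> by auto
      then show ?thesis using word_value_top[OF that] \<open>d > _\<close> by simp
    qed
    then have "additive_subgroup hull
      ({c \<cdot> word_value u | c u. set u \<subseteq> {..<r} \<and> weight u = d} \<union> aug_power (Suc d)) \<subseteq> aug_power (Suc d)"
      by (intro hull_minimal aug_power_subgroup) (auto intro: aug_power_scale)
    then show ?thesis using aug_power_words by blast
  qed
  have "aug_power (Suc (weight full_word)) \<subseteq> (aug_power (Suc (weight full_word) + n) :: ('g, 'k) group_algebra set)" for n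
  proof (induction n)
    case (Suc n)
    then show ?case using step[of "Suc (weight full_word) + n"] by (auto)
  qed simp
  moreover have "aug_power (Suc (weight full_word) + K) \<subseteq> (aug_power K :: ('g, 'k) group_algebra set)"
    by (rule aug_power_antimono) simp
  ultimately have "aug_power (Suc (weight full_word)) \<subseteq> ({0} :: ('g, 'k) group_algebra set)"
    using K by blast
  then show ?thesis using additive_subgroup_zero[OF aug_power_subgroup] by blast
qed

end

section \<open>Products of linear forms modulo p-th powers\<close>

context
  fixes I :: "'r::comm_ring_1 set"
  assumes I: "two_sided_ideal I"
begin

lemma ideal_add: "x \<in> I \<Longrightarrow> y \<in> I \<Longrightarrow> x + y \<in> I"
  using I by (simp add: two_sided_ideal_def additive_subgroup_add)

lemma ideal_mult: "x \<in> I \<Longrightarrow> r * x \<in> I"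
  using I by (simp add: two_sided_ideal_def)

lemma ideal_sum: "(\<And>i. i \<in> A \<Longrightarrow> f i \<in> I) \<Longrightarrow> sum f A \<in> I"
  using I by (simp add: two_sided_ideal_def additive_subgroup_sum)

lemma ideal_zero: "0 \<in> I"
  using I by (simp add: two_sided_ideal_def additive_subgroup_zero)

lemma ideal_cong_power:
  assumes "e * (f - g) \<in> I"
  shows "e * (f ^ n - g ^ n) \<in> I"
proof (induction n)
  case (Suc n)
  have "e * (f ^ Suc n - g ^ Suc n) = f ^ n * (e * (f - g)) + g * (e * (f ^ n - g ^ n))"
    by (simp add: algebra_simps)
  then show ?case using ideal_add[OF ideal_mult[OF assms] ideal_mult[OF Suc]] by metis
qed (simp add: ideal_zero)

lemma ideal_cong_prod:
  assumes "finite A" and "\<And>i. i \<in> A \<Longrightarrow> e * (f i - g i) \<in> I"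
  shows "e * (prod f A - prod g A) \<in> I"
  using assms
proof (induction A rule: finite_induct)
  case (insert i A)
  have "e * (prod f (insert i A) - prod g (insert i A))
      = prod f A * (e * (f i - g i)) + g i * (e * (prod f A - prod g A))"
    using insert.hyps by (simp add: algebra_simps)
  moreover have "e * (f i - g i) \<in> I" "e * (prod f A - prod g A) \<in> I"
    using insert by auto
  ultimately show ?case using ideal_add[OF ideal_mult ideal_mult] by metis
qed (simp add: ideal_zero)

text \<open>
  Gaussian elimination on the matrix \<open>A\<close>, one column at a time. By the freshman's dream every linear form has its
  \<open>p\<close>-th power in \<open>I\<close>. So if a form \<open>y\<close> with nonzero coefficient at \<open>x q\<close> is used as pivot, then in the presence
  of \<open>y\<^bsup>p - 1\<^esup>\<close> multiples of \<open>y\<close> may be subtracted from the other forms to remove \<open>x q\<close> from them.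
  By induction those forms contribute all \<open>x k\<^bsup>p - 1\<^esup>\<close> with \<open>k \<in> K\<close>, and in the presence of these only the
  term of \<open>y\<close> at \<open>x q\<close> survives. If no form involves \<open>x q\<close>, there is one form too many in the remaining variables
  and the product vanishes. The scalar found in this way is the determinant of \<open>A\<close> up to sign.
\<close>

theorem linear_forms_power_product:
  fixes \<phi> :: "'k::field \<Rightarrow> 'r" and x :: "'i \<Rightarrow> 'r" and A :: "'j \<Rightarrow> 'i \<Rightarrow> 'k"
  assumes \<phi>_add: "\<And>a b. \<phi> (a + b) = \<phi> a + \<phi> b" and \<phi>_mult: "\<And>a b. \<phi> (a * b) = \<phi> a * \<phi> b"
    and \<phi>_one: "\<phi> 1 = 1"
    and p: "prime p" and char: "p = CHAR('r)"
    and "finite K" and "finite J" and "card J = card K"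
    and x: "\<And>k. k \<in> K \<Longrightarrow> x k ^ p \<in> I"
  shows "\<exists>c. (\<Prod>j\<in>J. (\<Sum>k\<in>K. \<phi> (A j k) * x k) ^ (p - 1)) - \<phi> c ^ (p - 1) * (\<Prod>k\<in>K. x k ^ (p - 1)) \<in> I"
  using assms(6-)
proof (induction K arbitrary: J A rule: finite_induct)
  case empty
  then show ?case by (intro exI[of _ 1]) (simp add: ideal_zero \<phi>_one)
next
  case (insert q K)
  have \<phi>_zero: "\<phi> 0 = 0" using \<phi>_add[of 0 0] by simp
  have \<phi>_minus: "\<phi> (a - b) = \<phi> a - \<phi> b" for a b
    using \<phi>_add[of "a - b" b] by simp
  have p1: "p = Suc (p - 1)" using prime_gt_0_nat[OF p] by simp
  let ?P = "\<Prod>k\<in>K. x k ^ (p - 1)"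
  define form where "form A j = (\<Sum>k\<in>K. \<phi> (A j k) * x k)" for A :: "'j \<Rightarrow> 'i \<Rightarrow> 'k" and j
  have split: "(\<Sum>k\<in>insert q K. \<phi> (A j k) * x k) = \<phi> (A j q) * x q + form A j" for j
    using insert.hyps by (simp add: form_def)
  have kill: "?P * form A j \<in> I" for j
  proof -
    have "?P * x k \<in> I" if k: "k \<in> K" for k
    proof -
      have "?P * x k = (\<Prod>k\<in>K - {k}. x k ^ (p - 1)) * x k ^ p"
        using k insert.hyps(1) by (subst p1, subst prod.remove[of K k]) (simp_all add: mult_ac)
      then show ?thesis using insert.prems(3) k by (simp add: ideal_mult)
    qed
    then have "(\<Sum>k\<in>K. \<phi> (A j k) * (?P * x k)) \<in> I"
      by (intro ideal_sum) (simp add: ideal_mult)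
    moreover have "?P * form A j = (\<Sum>k\<in>K. \<phi> (A j k) * (?P * x k))"
      unfolding form_def sum_distrib_left by (intro sum.cong) (simp_all only: mult_ac)
    ultimately show ?thesis by simp
  qed
  have "J \<noteq> {}" using insert.hyps insert.prems(2) by auto
  show ?case
  proof (cases "\<forall>j\<in>J. A j q = 0")
    case True
    \<comment> \<open>The forms other than \<open>j\<close> already produce a multiple of \<open>?P\<close>, which the form \<open>j\<close> annihilates.\<close>
    obtain j where j: "j \<in> J" using \<open>J \<noteq> {}\<close> by blast
    have "finite (J - {j})" "card (J - {j}) = card K"
      using insert.prems(1,2) insert.hyps j by auto
    then obtain c where c: "(\<Prod>j\<in>J - {j}. form A j ^ (p - 1)) - \<phi> c ^ (p - 1) * ?P \<in> I"
      using insert.IH[of "J - {j}" A] insert.prems(3) unfolding form_def by auto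
    have "form A j ^ (p - 1) * ?P \<in> I"
    proof -
      have "p - 1 = Suc (p - 2)" using prime_ge_2_nat[OF p] by simp
      then have "form A j ^ (p - 1) * ?P = form A j ^ (p - 2) * (?P * form A j)"
        by (simp only: power_Suc mult_ac)
      then show ?thesis by (simp only: ideal_mult kill)
    qed
    then have "form A j ^ (p - 1) * ((\<Prod>j\<in>J - {j}. form A j ^ (p - 1)) - \<phi> c ^ (p - 1) * ?P)
        + \<phi> c ^ (p - 1) * (form A j ^ (p - 1) * ?P) \<in> I"
      by (rule ideal_add[OF ideal_mult[OF c] ideal_mult])
    then have "form A j ^ (p - 1) * (\<Prod>j\<in>J - {j}. form A j ^ (p - 1)) \<in> I"
      by (simp add: algebra_simps)
    then have "(\<Prod>j\<in>J. form A j ^ (p - 1)) \<in> I"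
      using prod.remove[OF insert.prems(1) j, of "\<lambda>j. form A j ^ (p - 1)"] by simp
    moreover have "(\<Prod>j\<in>J. (\<Sum>k\<in>insert q K. \<phi> (A j k) * x k) ^ (p - 1)) = (\<Prod>j\<in>J. form A j ^ (p - 1))"
      using True by (intro prod.cong) (simp_all add: split \<phi>_zero)
    moreover have "(0::'r) ^ (p - 1) = 0" using prime_ge_2_nat[OF p] by (intro zero_power) simp
    ultimately show ?thesis by (intro exI[of _ 0]) (simp add: \<phi>_zero)
  next
    case False
    then obtain j where j: "j \<in> J" "A j q \<noteq> 0" by blast
    let ?full = "\<lambda>i. \<Sum>k\<in>insert q K. \<phi> (A i k) * x k"
    define y where "y = ?full j"
    define b where "b i = A i q / A j q" for i
    define B where "B i k = A i k - b i * A j k" for i k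
    have "finite (J - {j})" "card (J - {j}) = card K"
      using insert.prems(1,2) insert.hyps j by auto
    then obtain c where c: "(\<Prod>i\<in>J - {j}. form B i ^ (p - 1)) - \<phi> c ^ (p - 1) * ?P \<in> I"
      using insert.IH[of "J - {j}" B] insert.prems(3) unfolding form_def by auto
    have "y ^ p = (\<Sum>k\<in>insert q K. (\<phi> (A j k) * x k) ^ p)"
      unfolding y_def by (rule freshmans_dream_sum) (use p char in simp_all)
    also have "\<dots> \<in> I"
      using insert.prems(3) by (intro ideal_sum) (simp add: power_mult_distrib ideal_mult)
    finally have y: "y ^ p \<in> I" .
    have reduce: "?full i - form B i = \<phi> (b i) * y" for i
    proof -
      have "form B i = form A i - \<phi> (b i) * form A j"
        by (simp add: form_def B_def \<phi>_minus \<phi>_mult left_diff_distrib sum_subtractf sum_distrib_left mult.assoc)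
      moreover have "\<phi> (A i q) = \<phi> (b i) * \<phi> (A j q)"
        using j(2) by (simp add: b_def flip: \<phi>_mult)
      ultimately show ?thesis unfolding y_def split by (simp add: algebra_simps)
    qed
    \<comment> \<open>The three congruences of the elimination add up to the claim.\<close>
    have telescope: "Y * (F - G) + Y * (G - C * P) + C * (P * (Y - U * X)) = Y * F - C * U * (X * P)"
      for Y F G C P U X :: 'r
      by (simp add: algebra_simps)
    have "y ^ (p - 1) * (?full i - form B i) \<in> I" for i
    proof -
      have "y ^ (p - 1) * (?full i - form B i) = \<phi> (b i) * y ^ p"
        unfolding reduce by (subst (2) p1) (simp add: mult_ac)
      then show ?thesis using y by (simp add: ideal_mult)
    qed
    then have "y ^ (p - 1) * ((\<Prod>i\<in>J - {j}. ?full i ^ (p - 1)) - (\<Prod>i\<in>J - {j}. form B i ^ (p - 1))) \<in> I"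
      using insert.prems(1) by (intro ideal_cong_prod ideal_cong_power) auto
    moreover have "y ^ (p - 1) * ((\<Prod>i\<in>J - {j}. form B i ^ (p - 1)) - \<phi> c ^ (p - 1) * ?P) \<in> I"
      by (rule ideal_mult[OF c])
    moreover have "\<phi> c ^ (p - 1) * (?P * (y ^ (p - 1) - (\<phi> (A j q) * x q) ^ (p - 1))) \<in> I"
      by (rule ideal_mult[OF ideal_cong_power]) (use kill[of j] in \<open>simp add: y_def split\<close>)
    ultimately have "y ^ (p - 1) * ((\<Prod>i\<in>J - {j}. ?full i ^ (p - 1)) - (\<Prod>i\<in>J - {j}. form B i ^ (p - 1)))
        + y ^ (p - 1) * ((\<Prod>i\<in>J - {j}. form B i ^ (p - 1)) - \<phi> c ^ (p - 1) * ?P)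
        + \<phi> c ^ (p - 1) * (?P * (y ^ (p - 1) - (\<phi> (A j q) * x q) ^ (p - 1))) \<in> I"
      by (intro ideal_add)
    then have "y ^ (p - 1) * (\<Prod>i\<in>J - {j}. ?full i ^ (p - 1))
        - \<phi> (c * A j q) ^ (p - 1) * (x q ^ (p - 1) * ?P) \<in> I"
      by (simp only: \<phi>_mult power_mult_distrib telescope)
    also have "y ^ (p - 1) * (\<Prod>i\<in>J - {j}. ?full i ^ (p - 1)) = (\<Prod>i\<in>J. ?full i ^ (p - 1))"
      using prod.remove[OF insert.prems(1) j(1), of "\<lambda>i. ?full i ^ (p - 1)"] by (simp add: y_def)
    also have "x q ^ (p - 1) * ?P = (\<Prod>k\<in>insert q K. x k ^ (p - 1))"
      using insert.hyps by simp
    finally show ?thesis by blast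
  qed
qed

end

type_synonym 'k mpoly = "(nat \<Rightarrow>\<^sub>0 nat) \<Rightarrow>\<^sub>0 'k"

definition const :: "'k::field \<Rightarrow> 'k mpoly"
  where "const a = Poly_Mapping.single 0 a"

definition var :: "nat \<Rightarrow> 'k::field mpoly"
  where "var i = Poly_Mapping.single (Poly_Mapping.single i 1) 1"

definition exponents :: "nat list \<Rightarrow> nat \<Rightarrow>\<^sub>0 nat"
  where "exponents u = sum_list (map (\<lambda>i. Poly_Mapping.single i 1) u)"

definition monomial :: "nat list \<Rightarrow> 'k::field mpoly"
  where "monomial u = prod_list (map var u)"

lemma lookup_exponents: "Poly_Mapping.lookup (exponents u) i = count (mset u) i"
  by (induction u) (simp_all add: exponents_def lookup_add lookup_single when_def)

lemma exponents_eq_iff: "exponents u = exponents v \<longleftrightarrow> mset u = mset v"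
  by (simp add: poly_mapping_eq_iff fun_eq_iff lookup_exponents multiset_eq_iff)

lemma monomial_eq: "monomial u = Poly_Mapping.single (exponents u) 1"
  by (induction u) (simp_all add: monomial_def exponents_def var_def mult_single)

lemma lookup_monomial:
  "Poly_Mapping.lookup (monomial u :: 'k::field mpoly) (exponents v) = (if mset u = mset v then 1 else 0)"
  by (simp add: monomial_eq lookup_single when_def exponents_eq_iff)

lemma lookup_const_mult: "Poly_Mapping.lookup (const a * P) t = a * Poly_Mapping.lookup (P :: 'k::field mpoly) t"
  unfolding const_def by (simp add: Poly_Mapping.map.rep_eq when_def flip: mult_map_scale_conv_mult)

lemma CHAR_mpoly: "CHAR('k::field mpoly) = CHAR('k)"
proof (rule CHAR_eqI)
  show "of_nat CHAR('k) = (0 :: 'k mpoly)"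
    by (metis of_nat_CHAR single_of_nat single_zero)
  show "CHAR('k) dvd n" if "of_nat n = (0 :: 'k mpoly)" for n
  proof -
    have "Poly_Mapping.lookup (of_nat n :: 'k mpoly) 0 = of_nat n"
      by (simp add: lookup_of_nat)
    then show ?thesis using that by (simp add: of_nat_eq_0_iff_char_dvd)
  qed
qed

text \<open>
  Polynomials all of whose multiples have vanishing coefficient at the monomial \<open>full\<close> form an ideal. It contains
  the \<open>p\<close>-th powers of the variables, since the exponents of \<open>full\<close> are below \<open>p\<close>. Reading off the coefficient
  is therefore well defined modulo this ideal.
\<close>

theorem top_coefficient_linear_forms:
  fixes A :: "nat \<Rightarrow> nat \<Rightarrow> 'k::field"
  assumes p: "prime p" and char: "CHAR('k) = p"
    and full: "\<And>i. i < r \<Longrightarrow> count (mset full) i = p - 1"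
    and full_monomial: "monomial full = (\<Prod>i<r. var i ^ (p - 1) :: 'k mpoly)"
  shows "\<exists>c. Poly_Mapping.lookup (\<Prod>j<r. (\<Sum>k<r. const (A j k) * var k) ^ (p - 1)) (exponents full) = c ^ (p - 1)"
proof -
  define I where "I = {P :: 'k mpoly. \<forall>Q. Poly_Mapping.lookup (Q * P) (exponents full) = 0}"
  have I: "two_sided_ideal I"
  proof -
    have "additive_subgroup I"
      by (simp add: additive_subgroup_def I_def right_diff_distrib lookup_minus)
    moreover have left: "R * P \<in> I" if "P \<in> I" for P R
      using that by (simp add: I_def flip: mult.assoc)
    moreover have "P * R \<in> I" if "P \<in> I" for P R
      using left[OF that, of R] by (simp only: mult.commute)
    ultimately show ?thesis by (simp add: two_sided_ideal_def)
  qed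
  have var_power: "var i ^ n = (Poly_Mapping.single (Poly_Mapping.single i n) 1 :: 'k mpoly)" for i n
    by (induction n) (simp_all add: var_def mult_single flip: single_add)
  have var_I: "var i ^ p \<in> I" if "i < r" for i
  proof -
    have "exponents full \<noteq> l + Poly_Mapping.single i p" for l
    proof
      assume "exponents full = l + Poly_Mapping.single i p"
      then have "count (mset full) i = Poly_Mapping.lookup l i + p"
        by (metis lookup_add lookup_exponents lookup_single_eq)
      then show False using full[OF that] prime_gt_0_nat[OF p] by simp
    qed
    then have "(Poly_Mapping.lookup (var i ^ p :: 'k mpoly) q when exponents full = l + q) = 0" for l q
      by (auto simp: var_power lookup_single when_def)
    then show ?thesis by (simp add: I_def lookup_mult)
  qed
  have const: "const (a + b) = const a + (const b :: 'k mpoly)" "const (a * b) = const a * (const b :: 'k mpoly)"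
    "const 1 = (1 :: 'k mpoly)" for a b :: 'k
    by (simp_all add: const_def single_add mult_single)
  have const_power: "const (a ^ n) = (const a ^ n :: 'k mpoly)" for a :: 'k and n
    by (induction n) (simp_all add: const)
  obtain c where "(\<Prod>j<r. (\<Sum>k<r. const (A j k) * var k) ^ (p - 1)) - const c ^ (p - 1) * monomial full \<in> I"
    using linear_forms_power_product[OF I const p, of "{..<r}" "{..<r}" var A] var_I
    by (auto simp: char CHAR_mpoly full_monomial)
  then have "Poly_Mapping.lookup (1 * ((\<Prod>j<r. (\<Sum>k<r. const (A j k) * var k) ^ (p - 1))
      - const (c ^ (p - 1)) * monomial full)) (exponents full) = 0"
    unfolding I_def const_power by blast
  then have "Poly_Mapping.lookup (\<Prod>j<r. (\<Sum>k<r. const (A j k) * var k) ^ (p - 1)) (exponents full) = c ^ (p - 1)"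
    by (simp add: lookup_minus lookup_const_mult lookup_monomial)
  then show ?thesis ..
qed

lemma finite_field_fermat:
  fixes a :: "'k::field"
  assumes "finite (UNIV :: 'k set)" and "a \<noteq> 0"
  shows "a ^ (CARD('k) - 1) = 1"
proof -
  let ?U = "UNIV - {0} :: 'k set"
  have "(\<Prod>x\<in>?U. x) = (\<Prod>x\<in>?U. a * x)"
    by (rule prod.reindex_bij_witness[of _ "\<lambda>x. a * x" "\<lambda>x. x / a"]) (use assms(2) in auto)
  also have "\<dots> = a ^ (CARD('k) - 1) * (\<Prod>x\<in>?U. x)"
    using assms(1) by (simp add: prod.distrib card_Diff_subset)
  finally show ?thesis using assms(1) by (simp add: prod_zero_iff)
qed

section \<open>The action on the sum of the group elements\<close>

context adapted_generators
begin

lemma span_of_weight_coordinates: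
  assumes "x \<in> span_of_weight n"
  obtains a where "\<And>i. a i \<noteq> 0 \<Longrightarrow> i < r \<and> wt i = n"
    and "x - (\<Sum>i<r. a i \<cdot> letter i) \<in> aug_power (Suc n)"
proof -
  have "\<exists>a. (\<forall>i. a i \<noteq> 0 \<longrightarrow> i < r \<and> wt i = n) \<and> x - (\<Sum>i<r. a i \<cdot> letter i) \<in> aug_power (Suc n)"
    using assms
  proof (induction rule: span_of_weight_induct)
    case (letter c i)
    have "(\<Sum>j<r. (if j = i then c else 0) \<cdot> letter j) = (\<Sum>j<r. if j = i then c \<cdot> letter i else 0)"
      by (rule sum.cong) auto
    also have "\<dots> = c \<cdot> letter i" using letter by simp
    finally show ?case
      using letter by (intro exI[of _ "\<lambda>j. if j = i then c else 0"])
        (simp add: additive_subgroup_zero aug_power_subgroup)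
  next
    case (higher x)
    then show ?case by (intro exI[of _ "\<lambda>_. 0"]) simp
  next
    case zero
    show ?case
      by (intro exI[of _ "\<lambda>_. 0"]) (simp add: additive_subgroup_zero aug_power_subgroup)
  next
    case (diff x y)
    then obtain a b where
      a: "\<forall>i. a i \<noteq> 0 \<longrightarrow> i < r \<and> wt i = n" "x - (\<Sum>i<r. a i \<cdot> letter i) \<in> aug_power (Suc n)" and
      b: "\<forall>i. b i \<noteq> 0 \<longrightarrow> i < r \<and> wt i = n" "y - (\<Sum>i<r. b i \<cdot> letter i) \<in> aug_power (Suc n)"
      by blast
    have "(x - y) - (\<Sum>i<r. (a i - b i) \<cdot> letter i)
        = (x - (\<Sum>i<r. a i \<cdot> letter i)) - (y - (\<Sum>i<r. b i \<cdot> letter i))"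
      by (simp add: group_algebra.scale_left_diff_distrib sum_subtractf)
    then have "(x - y) - (\<Sum>i<r. (a i - b i) \<cdot> letter i) \<in> aug_power (Suc n)"
      using additive_subgroup_diff[OF aug_power_subgroup a(2) b(2)] by metis
    moreover have "i < r \<and> wt i = n" if "a i - b i \<noteq> 0" for i
    proof -
      have "a i \<noteq> 0 \<or> b i \<noteq> 0" using that by auto
      then show ?thesis using a(1) b(1) by blast
    qed
    ultimately show ?case by (intro exI[of _ "\<lambda>i. a i - b i"]) simp
  qed
  then show ?thesis using that by blast
qed

abbreviation linear_form :: "(nat \<Rightarrow> nat \<Rightarrow> 'k) \<Rightarrow> nat \<Rightarrow> 'k mpoly"
  where "linear_form A j \<equiv> \<Sum>k<r. const (A j k) * var k"

text \<open>
  Multiplying out a product of combinations of letters yields words of top weight, and by \<open>word_value_top\<close>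
  these multiply like commuting variables whose \<open>p\<close>-th powers vanish. The error terms of the \<open>z j\<close> raise the
  weight beyond the top. The prefix \<open>pre\<close> collects the letters already chosen.
\<close>

lemma product_top_coefficient:
  fixes z :: "nat \<Rightarrow> ('g, 'k) group_algebra" and A :: "nat \<Rightarrow> nat \<Rightarrow> 'k"
  assumes A: "\<And>j k. j < r \<Longrightarrow> A j k \<noteq> 0 \<Longrightarrow> k < r \<and> wt k = wt j"
    and z: "\<And>j. j < r \<Longrightarrow> z j - (\<Sum>k<r. A j k \<cdot> letter k) \<in> aug_power (Suc (wt j))"
    and "set pre \<subseteq> {..<r}" and "set u \<subseteq> {..<r}"
    and "weight pre + weight u = weight full_word" and "length pre + length u \<le> length full_word"
  shows "word_value pre * prod_list (map z u) - Poly_Mapping.lookup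
      (monomial pre * prod_list (map (linear_form A) u)) (exponents full_word) \<cdot> word_value full_word
    \<in> aug_power (Suc (weight full_word))"
  using assms(3-)
proof (induction u arbitrary: pre)
  case Nil
  have "Poly_Mapping.lookup (monomial pre :: 'k mpoly) (exponents full_word) \<cdot> word_value full_word
      = (if mset pre = mset full_word then word_value full_word else 0)"
    by (simp add: lookup_monomial)
  then show ?case
    using word_value_top[of pre "weight full_word"] Nil by simp
next
  case (Cons j u)
  let ?N = "Suc (weight full_word)" and ?n = "word_value full_word"
  let ?top = "\<lambda>P :: 'k mpoly. Poly_Mapping.lookup P (exponents full_word)"
  let ?z = "prod_list (map z u)" and ?P = "prod_list (map (linear_form A) u)"
  have j: "j < r" using Cons.prems by simp
  have z_aug: "z i \<in> aug_power (wt i)" if i: "i < r" for i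
  proof -
    have "A i k \<cdot> letter k \<in> aug_power (wt i)" for k
      using A[OF i, of k] letter_aug_power[of k]
      by (cases "A i k = 0") (auto intro: aug_power_scale additive_subgroup_zero aug_power_subgroup)
    then have "(\<Sum>k<r. A i k \<cdot> letter k) \<in> aug_power (wt i)"
      by (intro additive_subgroup_sum aug_power_subgroup)
    moreover have "z i - (\<Sum>k<r. A i k \<cdot> letter k) \<in> aug_power (wt i)"
      using z[OF i] aug_power_antimono[of "wt i" "Suc (wt i)"] by (meson lessI less_imp_le subsetD)
    ultimately show ?thesis
      using additive_subgroup_add[OF aug_power_subgroup] by fastforce
  qed
  have tail_aug: "prod_list (map z v) \<in> aug_power (weight v)" if "set v \<subseteq> {..<r}" for v
    using that by (induction v) (auto intro: aug_power_mult z_aug)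
  have "word_value pre * (z j - (\<Sum>k<r. A j k \<cdot> letter k)) * ?z
      \<in> aug_power (weight pre + Suc (wt j) + weight u)"
    using Cons.prems j by (intro aug_power_mult word_value_aug_power z tail_aug) auto
  moreover have "weight pre + Suc (wt j) + weight u = ?N" using Cons.prems(3) by simp
  ultimately have error: "word_value pre * (z j - (\<Sum>k<r. A j k \<cdot> letter k)) * ?z \<in> aug_power ?N"
    by (simp only:)
  have "A j k \<cdot> (word_value (pre @ [k]) * ?z - ?top (monomial (pre @ [k]) * ?P) \<cdot> ?n) \<in> aug_power ?N" for k
  proof (cases "A j k = 0")
    case True
    then show ?thesis by (simp add: additive_subgroup_zero aug_power_subgroup)
  next
    case False
    then have "k < r" "wt k = wt j" using A[OF j] by auto
    then show ?thesis
      using Cons.prems by (intro aug_power_scale Cons.IH) auto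
  qed
  then have main: "(\<Sum>k<r. A j k \<cdot> (word_value (pre @ [k]) * ?z - ?top (monomial (pre @ [k]) * ?P) \<cdot> ?n)) \<in> aug_power ?N"
    by (intro additive_subgroup_sum aug_power_subgroup)
  have "word_value pre * (\<Sum>k<r. A j k \<cdot> letter k) * ?z = (\<Sum>k<r. A j k \<cdot> (word_value (pre @ [k]) * ?z))"
    by (simp add: sum_distrib_left sum_distrib_right scale_mult_left scale_mult_right)
  moreover have "?top (monomial pre * (linear_form A j * ?P)) = (\<Sum>k<r. A j k * ?top (monomial (pre @ [k]) * ?P))"
  proof -
    have "monomial pre * (linear_form A j * ?P) = (\<Sum>k<r. const (A j k) * (monomial (pre @ [k]) * ?P))"
      unfolding sum_distrib_left sum_distrib_right
      by (intro sum.cong) (simp_all add: monomial_def mult_ac)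
    then show ?thesis by (simp only: lookup_sum lookup_const_mult)
  qed
  ultimately have "word_value pre * prod_list (map z (j # u))
      - ?top (monomial pre * prod_list (map (linear_form A) (j # u))) \<cdot> ?n
    = (\<Sum>k<r. A j k \<cdot> (word_value (pre @ [k]) * ?z - ?top (monomial (pre @ [k]) * ?P) \<cdot> ?n))
      + word_value pre * (z j - (\<Sum>k<r. A j k \<cdot> letter k)) * ?z"
    by (simp add: group_algebra.scale_right_diff_distrib sum_subtractf group_algebra.scale_sum_left
        right_diff_distrib left_diff_distrib mult.assoc)
  then show ?case
    using additive_subgroup_add[OF aug_power_subgroup main error] by (simp only:)
qed

lemma prod_list_full_word:
  "prod_list (map f full_word) = prod_list (map (\<lambda>i. f i ^ (p - 1)) [0..<r])"
  for f :: "nat \<Rightarrow> 'a::monoid_mult"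
proof -
  have "prod_list (map f (concat (map (replicate n) xs))) = prod_list (map (\<lambda>i. f i ^ n) xs)" for n and xs :: "nat list"
    by (induction xs) simp_all
  then show ?thesis by (simp add: full_word_def)
qed

text \<open>
  The rows of \<open>A\<close> are the coordinates of the images of the letters in the Lie algebra, so \<open>A\<close> is the matrix of the
  map that \<open>\<alpha>\<close> induces on \<open>L\<close>.
\<close>

theorem automorphism_full_word:
  assumes \<alpha>: "algebra_automorphism (\<alpha> :: ('g, 'k) group_algebra \<Rightarrow> ('g, 'k) group_algebra)"
    and CHAR: "CHAR('k) = p"
  shows "\<exists>\<mu>. \<alpha> (word_value full_word) = \<mu> ^ (p - 1) \<cdot> word_value full_word"
proof -
  obtain m where card: "CARD('g) = p ^ m" using p_group by blast
  have "\<forall>j\<in>{..<r}. \<exists>a. (\<forall>k. a k \<noteq> 0 \<longrightarrow> k < r \<and> wt k = wt j)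
      \<and> \<alpha> (letter j) - (\<Sum>k<r. a k \<cdot> letter k) \<in> aug_power (Suc (wt j))"
  proof
    fix j assume "j \<in> {..<r}"
    then have "j < r" by simp
    have "\<alpha> (letter j) = \<alpha> (grp (gen j)) - 1"
      by (simp add: letter_def algebra_automorphism_simps[OF \<alpha>])
    also have "\<dots> \<in> dimension_space p (wt j)"
      by (rule automorphism_dimension_space[OF p char card \<alpha> gen[OF \<open>j < r\<close>]])
    finally have "\<alpha> (letter j) \<in> span_of_weight (wt j)"
      using dimension_space_span_of_weight by blast
    then show "\<exists>a. (\<forall>k. a k \<noteq> 0 \<longrightarrow> k < r \<and> wt k = wt j)
        \<and> \<alpha> (letter j) - (\<Sum>k<r. a k \<cdot> letter k) \<in> aug_power (Suc (wt j))"
      by (rule span_of_weight_coordinates) blast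
  qed
  from bchoice[OF this] obtain A where A: "\<And>j k. j < r \<Longrightarrow> A j k \<noteq> 0 \<Longrightarrow> k < r \<and> wt k = wt j"
    and z: "\<And>j. j < r \<Longrightarrow> \<alpha> (letter j) - (\<Sum>k<r. A j k \<cdot> letter k) \<in> aug_power (Suc (wt j))"
    by (auto)
  have list_prod: "prod_list (map f [0..<n]) = (\<Prod>i<n. f i)" for f :: "nat \<Rightarrow> 'k mpoly" and n
    by (induction n) simp_all
  have "\<exists>\<mu>. Poly_Mapping.lookup (\<Prod>j<r. linear_form A j ^ (p - 1)) (exponents full_word) = \<mu> ^ (p - 1)"
    by (rule top_coefficient_linear_forms[OF p CHAR])
      (simp_all add: count_full_word monomial_def prod_list_full_word list_prod)
  then obtain \<mu> where \<mu>: "Poly_Mapping.lookup (prod_list (map (linear_form A) full_word)) (exponents full_word) = \<mu> ^ (p - 1)"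
    by (auto simp: prod_list_full_word list_prod)
  have "\<alpha> (prod_list xs) = prod_list (map \<alpha> xs)" for xs
    by (induction xs) (simp_all add: algebra_automorphism_simps[OF \<alpha>])
  then have "\<alpha> (word_value full_word) = prod_list (map (\<lambda>j. \<alpha> (letter j)) full_word)"
    by (simp add: word_value_def comp_def)
  moreover have "prod_list (map (\<lambda>j. \<alpha> (letter j)) full_word) - \<mu> ^ (p - 1) \<cdot> word_value full_word
      \<in> aug_power (Suc (weight full_word))"
    using product_top_coefficient[of A "\<lambda>j. \<alpha> (letter j)" "[]" full_word] A z set_full_word \<mu>
    by (simp add: monomial_def)
  ultimately show ?thesis
    unfolding aug_power_top by auto
qed

end

section \<open>The socle\<close>

lemma mult_sum_group:
  fixes x :: "('g::{finite, group_add}, 'k::field) group_algebra"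
  shows "x * (\<Sum>h\<in>UNIV. grp h) = augmentation x \<cdot> (\<Sum>h\<in>UNIV. grp h)"
proof -
  have shift: "grp g * (\<Sum>h\<in>UNIV. grp h) = (\<Sum>h\<in>UNIV. grp h :: ('g, 'k) group_algebra)" for g
    unfolding sum_distrib_left grp_add[symmetric]
    by (rule sum.reindex_bij_witness[of _ "\<lambda>h. - g + h" "\<lambda>h. g + h"]) (simp_all flip: add.assoc)
  have "x * (\<Sum>h\<in>UNIV. grp h) = (\<Sum>g\<in>UNIV. Poly_Mapping.lookup x g \<cdot> grp g) * (\<Sum>h\<in>UNIV. grp h)"
    using group_algebra_expansion[of x] by simp
  also have "\<dots> = (\<Sum>g\<in>UNIV. Poly_Mapping.lookup x g \<cdot> (\<Sum>h\<in>UNIV. grp h))"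
    by (simp only: sum_distrib_right scale_mult_left shift)
  finally show ?thesis
    by (simp add: augmentation_def group_algebra.scale_sum_left)
qed

lemma sum_group_nonzero: "(\<Sum>h\<in>UNIV. grp h) \<noteq> (0 :: ('g::{finite, group_add}, 'k::field) group_algebra)"
proof -
  have "Poly_Mapping.lookup (\<Sum>h\<in>UNIV. grp h :: ('g, 'k) group_algebra) 0 = 1"
    by (simp add: lookup_sum lookup_single when_def)
  then show ?thesis by auto
qed

text \<open>
  Every element of \<open>kG\<close> acts on the element sum through its augmentation, so the scalar multiples of this sum
  form a left ideal of dimension one.
\<close>

lemma sum_group_in_socle: "(\<Sum>h\<in>UNIV. grp h) \<in> (socle :: ('g::{finite, group_add}, 'k::field) group_algebra set)"
proof -
  define n where "n = (\<Sum>h\<in>UNIV. grp h :: ('g, 'k) group_algebra)"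
  have mult: "x * (c \<cdot> n) = (c * augmentation x) \<cdot> n" for x c
    by (simp add: n_def scale_mult_right mult_sum_group)
  let ?S = "range (\<lambda>c. c \<cdot> n)"
  have "n \<in> ?S" by (rule range_eqI[of _ _ 1]) simp
  have "minimal_left_ideal ?S"
    unfolding minimal_left_ideal_def
  proof (intro conjI allI impI)
    show "left_ideal ?S"
      unfolding left_ideal_def
    proof (intro conjI ballI allI)
      show "0 \<in> ?S" by (rule range_eqI[of _ _ 0]) simp
      show "x + y \<in> ?S" if "x \<in> ?S" "y \<in> ?S" for x y
        using that by (auto simp flip: group_algebra.scale_left_distrib)
      show "x * y \<in> ?S" if "y \<in> ?S" for x y
        using that by (auto simp: mult)
    qed
    show "?S \<noteq> {0}" using \<open>n \<in> ?S\<close> sum_group_nonzero n_def by auto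
    fix I :: "('g, 'k) group_algebra set"
    assume I: "left_ideal I \<and> I \<subseteq> ?S"
    show "I = {0} \<or> I = ?S"
    proof (cases "I \<subseteq> {0}")
      case True
      then show ?thesis using I by (auto simp: left_ideal_def)
    next
      case False
      then obtain c where c: "c \<cdot> n \<in> I" "c \<noteq> 0" using I by force
      have "d \<cdot> n \<in> I" for d
      proof -
        have "((d / c) \<cdot> 1) * (c \<cdot> n) \<in> I"
          using I c(1) by (simp only: left_ideal_def)
        then show ?thesis using c(2) by (simp add: mult augmentation_scale)
      qed
      then show ?thesis using I by blast
    qed
  qed
  then have "n \<in> socle"
    unfolding socle_def using \<open>n \<in> ?S\<close> by (intro hull_inc) blast
  then show ?thesis by (simp only: n_def)
qed

theorem theorem1p1:
  fixes p :: nat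
    and \<alpha> :: "('g::{finite, group_add}, 'k::field) group_algebra \<Rightarrow> ('g, 'k) group_algebra"
    and c :: 'k
  assumes "prime p"
    and "\<exists>m. CARD('g) = p ^ m"
    and "CHAR('k) = p"
    and "algebra_automorphism \<alpha>"
    and "c \<noteq> 0"
    and "\<forall>x\<in>socle. \<alpha> x = c \<cdot> x"
  shows "c \<in> {\<mu> ^ (p - 1) | \<mu>. \<mu> \<noteq> 0} \<and> (CARD('k) = p \<longrightarrow> c = 1)"
proof -
  note p = assms(1)
  have char: "of_nat p = (0::'k)"
    using assms(3) of_nat_CHAR by blast
  obtain m where card: "CARD('g) = p ^ m" using assms(2) by blast
  define n where "n = (\<Sum>h\<in>UNIV. grp h :: ('g, 'k) group_algebra)"
  obtain ls where ls: "\<And>v g. (v, g) \<in> set ls \<Longrightarrow> dimension_filtration p v g"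
    "n = prod_list (map (\<lambda>(v, g). (grp g - 1) ^ (p - 1)) ls)"
    "\<And>v h. dimension_filtration p v h \<Longrightarrow> grp h - 1 \<in> (letter_span ls v :: ('g, 'k) group_algebra set)"
    using adapted_letters_exist[OF p char card] unfolding n_def by blast
  define r where "r = length ls"
  define wt where "wt i = fst (ls ! i)" for i
  define gen where "gen i = snd (ls ! i)" for i
  have ls_eq: "map (\<lambda>i. (wt i, gen i)) [0..<r] = ls"
    by (simp add: wt_def gen_def r_def map_nth)
  interpret adapted_generators p r wt gen "TYPE('k)"
  proof
    show "dimension_filtration p (wt i) (gen i)" if "i < r" for i
      using ls(1)[of "wt i" "gen i"] that by (simp add: wt_def gen_def r_def)
  qed (use p char assms(2) ls(3) in \<open>simp_all add: ls_eq\<close>)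
  have "word_value full_word = prod_list (map (\<lambda>i. letter i ^ (p - 1)) [0..<r])"
    unfolding word_value_def by (rule prod_list_full_word)
  also have "\<dots> = prod_list (map (\<lambda>(v, g). (grp g - 1) ^ (p - 1)) (map (\<lambda>i. (wt i, gen i)) [0..<r]))"
    by (simp add: letter_def comp_def)
  finally have n: "word_value full_word = n"
    unfolding ls_eq ls(2) .
  obtain \<mu> where "\<alpha> n = \<mu> ^ (p - 1) \<cdot> n"
    using automorphism_full_word[OF assms(4,3)] n by auto
  moreover have "\<alpha> n = c \<cdot> n"
    using assms(6) sum_group_in_socle n_def by blast
  ultimately have c: "c = \<mu> ^ (p - 1)"
    using sum_group_nonzero n_def by (metis group_algebra.scale_right_imp_eq)
  have "\<mu> \<noteq> 0"
    using assms(5) c prime_ge_2_nat[OF p] by (cases "\<mu> = 0") (auto simp: zero_power)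
  moreover have "c = 1" if "CARD('k) = p"
  proof -
    have "finite (UNIV :: 'k set)"
      using that prime_gt_0_nat[OF p] by (intro card_ge_0_finite) simp
    then show ?thesis using finite_field_fermat \<open>\<mu> \<noteq> 0\<close> c that by metis
  qed
  ultimately show ?thesis using c by blast
qed

end
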